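(* Let $\Lambda_4=\{\sum_{j=0}^\infty d_j4^j:\ d_j\in\{0,1\},\ \text{only finitely many } d_j\neq 0\}$ and let $K\ge3$ be an odd integer. Then $K\Lambda_4=\{K\lambda:\lambda\in\Lambda_4\}$ is a spectrum of the Bernoulli convolution $\mu_4$ if and only if there does not exist a positive integer $N$ such that $$K\sum_{j=1}^{N}d_j4^{j-1}\in(4^N-1)\mathbb Z\setminus\{0\}$$ for some $d_j\in\{0,1\}$, $1\le j\le N$.
   Context: The Bernoulli convolution $\mu_4$ is the unique Borel probability measure on $\mathbb R$ with $\mu_4=\frac12\sum_{i=0}^{1}\mu_4(f_i^{-1}(\cdot))$, where $f_i(x)=x/4+i/2$, $i=0,1$. A countable set $\Lambda\subset\mathbb R$ is a spectrum of a probability measure $\mu$ if $\{e^{-2\pi i\lambda x}:\lambda\in\Lambda\}$ is an orthogonal basis of $L^2(\mu)$. *)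

theory Defs
  imports "HOL-Probability.Probability" "HOL-Real_Asymp.Real_Asymp"
begin

definition bc_map :: "nat \<Rightarrow> real \<Rightarrow> real" where
  "bc_map i x = x / 4 + real i / 2"

definition bc_invariant :: "real measure \<Rightarrow> bool" where
  "bc_invariant \<mu> \<longleftrightarrow>
     (\<forall>A\<in>sets borel. measure \<mu> A = 1 / 2 * (\<Sum>i=0..1. measure \<mu> (bc_map i -` A)))"

text \<open>The lemmas \<open>bernoulli_convolution4_ex1\<close> and \<open>bernoulli_convolution4_eqI\<close> below justify
  the definite description.\<close>

definition bernoulli_convolution4 :: "real measure" where
  "bernoulli_convolution4 = (THE \<mu>. prob_space \<mu> \<and> sets \<mu> = sets borel \<and> bc_invariant \<mu>)"

definition expo :: "real \<Rightarrow> real \<Rightarrow> complex" where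
  "expo l x = exp (- 2 * of_real pi * \<i> * of_real l * of_real x)"

text \<open>Measurable representatives of the elements of the complex space \<open>L\<^sup>2(\<mu>)\<close>.\<close>

definition square_integrable :: "real measure \<Rightarrow> (real \<Rightarrow> complex) \<Rightarrow> bool" where
  "square_integrable \<mu> f \<longleftrightarrow>
     f \<in> borel_measurable \<mu> \<and> integrable \<mu> (\<lambda>x. (cmod (f x))\<^sup>2)"

text \<open>An orthogonal basis of a Hilbert space is a family of nonzero, pairwise orthogonal vectors whose
  linear span is dense. The exponentials have norm 1 in \<open>L\<^sup>2(\<mu>)\<close> because \<open>\<mu>\<close> is a probability
  measure, so nonvanishing is automatic. The integrands are integrable (all exponentials are bounded
  and \<open>f\<close> is square integrable), so no integral below takes the default value 0 spuriously.\<close>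

definition is_spectrum :: "real measure \<Rightarrow> real set \<Rightarrow> bool" where
  "is_spectrum \<mu> L \<longleftrightarrow>
     countable L \<and>
     (\<forall>k\<in>L. \<forall>l\<in>L. k \<noteq> l \<longrightarrow> (LINT x|\<mu>. expo k x * cnj (expo l x)) = 0) \<and>
     (\<forall>f \<epsilon>. square_integrable \<mu> f \<longrightarrow> \<epsilon> > 0 \<longrightarrow>
        (\<exists>F c. finite F \<and> F \<subseteq> L \<and>
           (LINT x|\<mu>. (cmod (f x - (\<Sum>l\<in>F. c l * expo l x)))\<^sup>2) < \<epsilon>))"

definition Lambda4 :: "real set" where
  "Lambda4 = {(\<Sum>j. real (d j) * 4 ^ j) | d :: nat \<Rightarrow> nat.
                (\<forall>j. d j \<in> {0, 1}) \<and> finite {j. d j \<noteq> 0}}"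

lemma bc_map_measurable [measurable]: "bc_map i \<in> borel_measurable borel"
  unfolding bc_map_def[abs_def] by measurable

lemma half_ennreal_sum:
  fixes a b :: real
  assumes "a \<ge> 0" "b \<ge> 0"
  shows "ennreal (1 / 2) * ennreal a + ennreal (1 / 2) * ennreal b = ennreal (1 / 2 * (b + a))"
proof -
  have "ennreal (1 / 2) * ennreal a + ennreal (1 / 2) * ennreal b
      = ennreal (1 / 2 * a) + ennreal (1 / 2 * b)"
    using assms by (subst (1 2) ennreal_mult) auto
  also have "\<dots> = ennreal (1 / 2 * a + 1 / 2 * b)"
    using assms by (subst ennreal_plus) auto
  also have "1 / 2 * a + 1 / 2 * b = 1 / 2 * (b + a)"
    by (simp add: field_simps)
  finally show ?thesis .
qed

lemma bc_invariant_distr: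
  assumes "prob_space \<mu>" and sets: "sets \<mu> = sets borel" and inv: "bc_invariant \<mu>"
  shows "\<mu> = distr (measure_pmf (bernoulli_pmf (1/2)) \<Otimes>\<^sub>M \<mu>) borel (\<lambda>(b, x). bc_map (of_bool b) x)"
proof (rule measure_eqI)
  interpret prob_space \<mu> by fact
  have [measurable_cong]: "sets \<mu> = sets borel" by fact
  have [simp]: "space \<mu> = UNIV" using sets_eq_imp_space_eq[OF sets] by simp
  have m[measurable]: "(\<lambda>(b, x). bc_map (of_bool b) x) \<in> borel_measurable (measure_pmf (bernoulli_pmf (1/2)) \<Otimes>\<^sub>M \<mu>)"
    unfolding bc_map_def[abs_def] case_prod_beta by measurable
  fix A assume "A \<in> sets \<mu>"
  then have A[measurable]: "A \<in> sets borel" by (simp add: sets)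
  let ?B = "measure_pmf (bernoulli_pmf (1/2))"
  have v: "Pair b -` ((\<lambda>(b, x). bc_map (of_bool b) x) -` A) = bc_map (of_bool b) -` A" for b
    by auto
  have "emeasure (distr (?B \<Otimes>\<^sub>M \<mu>) borel (\<lambda>(b, x). bc_map (of_bool b) x)) A
      = emeasure (?B \<Otimes>\<^sub>M \<mu>) ((\<lambda>(b, x). bc_map (of_bool b) x) -` A \<inter> space (?B \<Otimes>\<^sub>M \<mu>))"
    by (rule emeasure_distr[OF m A])
  also have "\<dots> = (\<integral>\<^sup>+b. emeasure \<mu> (bc_map (of_bool b) -` A) \<partial>?B)"
    using measurable_sets[OF m A]
    by (subst emeasure_pair_measure_alt) (auto simp: space_pair_measure v)
  also have "\<dots> = ennreal (1 / 2) * emeasure \<mu> (bc_map 1 -` A) + ennreal (1 / 2) * emeasure \<mu> (bc_map 0 -` A)"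
    by (simp add: mult.commute)
  also have "\<dots> = ennreal (1 / 2 * (\<Sum>i=0..1. measure \<mu> (bc_map i -` A)))"
    by (simp only: emeasure_eq_measure half_ennreal_sum[OF measure_nonneg measure_nonneg]) simp
  also have "\<dots> = emeasure \<mu> A"
    using inv A by (simp add: bc_invariant_def emeasure_eq_measure)
  finally show "emeasure \<mu> A = emeasure (distr (?B \<Otimes>\<^sub>M \<mu>) borel (\<lambda>(b, x). bc_map (of_bool b) x)) A"
    by simp
qed (simp add: sets)

lemma bc_invariant_char:
  assumes "prob_space \<mu>" and sets: "sets \<mu> = sets borel" and inv: "bc_invariant \<mu>"
  shows "char \<mu> t = (1 + iexp (t / 2)) / 2 * char \<mu> (t / 4)"
proof -
  interpret prob_space \<mu> by fact
  have [measurable_cong]: "sets \<mu> = sets borel" by fact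
  let ?B = "measure_pmf (bernoulli_pmf (1/2))"
  interpret P: pair_prob_space ?B \<mu>
    by unfold_locales
  have m[measurable]: "(\<lambda>(b, x). bc_map (of_bool b) x) \<in> borel_measurable (?B \<Otimes>\<^sub>M \<mu>)"
    unfolding bc_map_def[abs_def] case_prod_beta by measurable
  have int: "integrable (?B \<Otimes>\<^sub>M \<mu>) (\<lambda>(b, x). iexp (t * bc_map (of_bool b) x))"
    by (rule P.integrable_const_bound[where B=1]) (auto simp: case_prod_beta bc_map_def)
  have "char \<mu> t = (CLINT z|?B \<Otimes>\<^sub>M \<mu>. iexp (t * (case z of (b, x) \<Rightarrow> bc_map (of_bool b) x)))"
    unfolding char_def by (subst bc_invariant_distr[OF assms]) (subst integral_distr[OF m], auto)
  also have "\<dots> = (CLINT z|?B \<Otimes>\<^sub>M \<mu>. (case z of (b, x) \<Rightarrow> iexp (t * bc_map (of_bool b) x)))"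
    by (simp add: case_prod_beta)
  also have "\<dots> = (CLINT b|?B. CLINT x|\<mu>. iexp (t * bc_map (of_bool b) x))"
    using P.integral_fst[of "\<lambda>b x. iexp (t * bc_map (of_bool b) x)"] int by simp
  also have "\<dots> = (CLINT b|?B. iexp (t * of_bool b / 2) * char \<mu> (t / 4))"
  proof (rule Bochner_Integration.integral_cong)
    fix b
    have "(CLINT x|\<mu>. iexp (t * bc_map (of_bool b) x))
        = (CLINT x|\<mu>. iexp (t * of_bool b / 2) * iexp (t / 4 * x))"
      by (simp add: bc_map_def exp_add[symmetric] algebra_simps)
    then show "(CLINT x|\<mu>. iexp (t * bc_map (of_bool b) x)) = iexp (t * of_bool b / 2) * char \<mu> (t / 4)"
      by (simp add: char_def)
  qed simp
  also have "\<dots> = (1 + iexp (t / 2)) / 2 * char \<mu> (t / 4)"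
    by (subst integral_measure_pmf[of UNIV])
       (auto simp: UNIV_bool scaleR_conv_of_real field_simps)
  finally show ?thesis .
qed

lemma bc_invariant_unique:
  assumes "prob_space \<mu>" "sets \<mu> = sets borel" "bc_invariant \<mu>"
    and "prob_space \<nu>" "sets \<nu> = sets borel" "bc_invariant \<nu>"
  shows "\<mu> = \<nu>"
proof -
  have rd: "real_distribution \<mu>" "real_distribution \<nu>"
    using assms sets_eq_imp_space_eq[of \<mu> borel] sets_eq_imp_space_eq[of \<nu> borel]
    by (auto simp: real_distribution_def real_distribution_axioms_def)
  define D where "D t = char \<mu> t - char \<nu> t" for t
  have step: "cmod (D t) \<le> cmod (D (t / 4))" for t
  proof -
    have "D t = (1 + iexp (t / 2)) / 2 * D (t / 4)"
      unfolding D_def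
      by (subst bc_invariant_char[OF assms(1-3)], subst bc_invariant_char[OF assms(4-6)])
         (simp add: right_diff_distrib)
    then have "cmod (D t) = cmod ((1 + iexp (t / 2)) / 2) * cmod (D (t / 4))"
      by (simp only: norm_mult)
    moreover have "cmod ((1 + iexp (t / 2)) / 2) \<le> 1"
      using norm_triangle_ineq[of 1 "iexp (t / 2)"] by (simp add: norm_divide)
    ultimately show ?thesis by (simp only: mult_left_le_one_le norm_ge_zero)
  qed
  have iter: "cmod (D t) \<le> cmod (D (t / 4 ^ n))" for t n
  proof (induction n)
    case (Suc n)
    then show ?case using step[of "t / 4 ^ n"] by (simp add: mult.commute)
  qed simp
  have "D t = 0" for t
  proof -
    have "isCont D 0"
      unfolding D_def[abs_def] using rd by (intro continuous_intros real_distribution.isCont_char)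
    moreover have "(\<lambda>n. t / 4 ^ n) \<longlonglongrightarrow> 0"
      by real_asymp
    ultimately have "(\<lambda>n. cmod (D (t / 4 ^ n))) \<longlonglongrightarrow> cmod (D 0)"
      by (intro tendsto_norm isCont_tendsto_compose[of 0 D])
    then have "cmod (D t) \<le> cmod (D 0)"
      by (rule LIMSEQ_le_const) (use iter in auto)
    also have "D 0 = 0"
      using rd by (simp add: D_def real_distribution.char_zero)
    finally show ?thesis by simp
  qed
  then have "char \<mu> = char \<nu>" by (auto simp: D_def fun_eq_iff)
  with rd show ?thesis by (rule Levy_uniqueness)
qed

lemma bc_invariant_ex: "\<exists>\<mu>. prob_space \<mu> \<and> sets \<mu> = sets borel \<and> bc_invariant \<mu>"
proof -
  let ?B = "measure_pmf (bernoulli_pmf (1/2))"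
  let ?S = "stream_space ?B"
  interpret S: prob_space ?S by (rule prob_space.prob_space_stream_space[OF measure_pmf.prob_space_axioms])
  define X :: "bool stream \<Rightarrow> real" where "X \<omega> = (\<Sum>n. of_bool (\<omega> !! n) / 2 * (1 / 4) ^ n)" for \<omega>
  have dig[measurable]: "(\<lambda>\<omega>. of_bool (\<omega> !! n) :: real) \<in> borel_measurable ?S" for n
    by (rule measurable_compose[OF measurable_snth]) simp
  have X[measurable]: "X \<in> borel_measurable ?S"
    unfolding X_def[abs_def] by measurable
  have spS: "space ?S = UNIV" by (simp add: space_stream_space)
  have sm: "summable (\<lambda>n. of_bool (\<omega> !! n) / 2 * (1 / 4 :: real) ^ n)" for \<omega>
    by (rule summable_comparison_test'[where g="\<lambda>n. (1 / 4 :: real) ^ n" and N=0])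
       (auto intro!: summable_geometric)
  have Xc: "X (b ## \<omega>) = bc_map (of_bool b) (X \<omega>)" for b \<omega>
  proof -
    have "X (b ## \<omega>) = of_bool b / 2 + (\<Sum>n. (1 / 4) * (of_bool (\<omega> !! n) / 2 * (1 / 4) ^ n))"
      unfolding X_def using suminf_split_head[OF sm[of "b ## \<omega>"]] by (simp add: field_simps)
    also have "\<dots> = of_bool b / 2 + X \<omega> / 4"
      unfolding X_def by (subst suminf_mult[OF sm]) simp
    finally show ?thesis by (simp add: bc_map_def)
  qed
  define \<nu> where "\<nu> = distr ?S borel X"
  interpret N: prob_space \<nu> unfolding \<nu>_def by (rule S.prob_space_distr[OF X])
  have "bc_invariant \<nu>"
    unfolding bc_invariant_def
  proof
    fix A :: "real set" assume A[measurable]: "A \<in> sets borel"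
    have pre: "bc_map i -` A \<in> sets borel" for i
      using measurable_sets[OF bc_map_measurable A] by simp
    have "emeasure \<nu> A = emeasure ?S (X -` A)"
      unfolding \<nu>_def by (subst emeasure_distr[OF X A]) (simp add: spS)
    also have "\<dots> = (\<integral>\<^sup>+b. emeasure ?S {\<omega>\<in>space ?S. b ## \<omega> \<in> X -` A} \<partial>?B)"
      using measurable_sets[OF X A] by (intro prob_space.emeasure_stream_space[OF measure_pmf.prob_space_axioms]) (simp add: spS)
    also have "\<dots> = (\<integral>\<^sup>+b. emeasure \<nu> (bc_map (of_bool b) -` A) \<partial>?B)"
    proof (rule nn_integral_cong)
      fix b
      have "{\<omega>\<in>space ?S. b ## \<omega> \<in> X -` A} = X -` (bc_map (of_bool b) -` A) \<inter> space ?S"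
        by (auto simp: Xc)
      then show "emeasure ?S {\<omega>\<in>space ?S. b ## \<omega> \<in> X -` A} = emeasure \<nu> (bc_map (of_bool b) -` A)"
        unfolding \<nu>_def by (simp add: emeasure_distr[OF X pre])
    qed
    also have "\<dots> = ennreal (1 / 2) * emeasure \<nu> (bc_map 1 -` A) + ennreal (1 / 2) * emeasure \<nu> (bc_map 0 -` A)"
      by (simp add: mult.commute)
    also have "\<dots> = ennreal (1 / 2 * (\<Sum>i=0..1. measure \<nu> (bc_map i -` A)))"
      by (simp only: N.emeasure_eq_measure half_ennreal_sum[OF measure_nonneg measure_nonneg]) simp
    finally show "measure \<nu> A = 1 / 2 * (\<Sum>i=0..1. measure \<nu> (bc_map i -` A))"
      by (simp add: N.emeasure_eq_measure sum_nonneg)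
  qed
  then show ?thesis
    by (intro exI[of _ \<nu>]) (auto simp: \<nu>_def intro!: S.prob_space_distr)
qed

lemma bernoulli_convolution4_ex1:
  "\<exists>!\<mu>. prob_space \<mu> \<and> sets \<mu> = sets borel \<and> bc_invariant \<mu>"
  by (intro ex_ex1I bc_invariant_ex) (blast intro: bc_invariant_unique)

lemma
  shows prob_space_bernoulli_convolution4: "prob_space bernoulli_convolution4"
    and sets_bernoulli_convolution4 [simp]: "sets bernoulli_convolution4 = sets borel"
    and bc_invariant_bernoulli_convolution4: "bc_invariant bernoulli_convolution4"
  using theI'[OF bernoulli_convolution4_ex1] unfolding bernoulli_convolution4_def by blast+

lemma bernoulli_convolution4_eqI:
  "prob_space \<mu> \<Longrightarrow> sets \<mu> = sets borel \<Longrightarrow> bc_invariant \<mu> \<Longrightarrow> \<mu> = bernoulli_convolution4"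
  using bc_invariant_unique prob_space_bernoulli_convolution4 sets_bernoulli_convolution4
    bc_invariant_bernoulli_convolution4 by blast

end

theory Submission
  imports Defs
begin

text \<open>
  Write \<open>h(t)\<close> for the squared modulus of the Fourier transform of \<open>\<mu>\<^sub>4\<close> and
  \<open>Q(t) = \<Sum>\<lambda>\<in>K \<Lambda>\<^sub>4. h(t + \<lambda>)\<close>. Any two points of \<open>K \<Lambda>\<^sub>4\<close> differ by \<open>4\<^sup>n\<close> times an odd
  integer, which is a zero of \<open>h\<close>, so the exponentials are orthonormal, and \<open>Q \<le> 1\<close> by Bessel's
  inequality. They are complete iff \<open>Q\<close> is constantly 1. Self-similarity makes \<open>Q\<close> a fixed point of
  the transfer operator
  \<open>Q(t) = cos\<^sup>2(\<pi>t/2) Q(t/4) + sin\<^sup>2(\<pi>t/2) Q((t + K)/4)\<close>.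
  If \<open>Q\<close> had a minimum below 1 on a large interval, the branches with positive weight would preserve
  the set of minimizers. A minimizer must be a nonzero integer, since otherwise the minimizers
  \<open>t/4\<^sup>n\<close> would accumulate at 0, where \<open>Q = 1\<close>; so the minimizers are finitely many nonzero
  integers and contain a cycle of the maps \<open>x \<mapsto> (x + K d)/4\<close>, \<open>d \<in> {0, 1}\<close>. Conversely, for a point \<open>x\<close> of
  such a cycle \<open>h\<close> vanishes on \<open>x + K \<Lambda>\<^sub>4\<close>, so the exponential of frequency \<open>- x\<close> is orthogonal to
  all the others.
\<close>

subsection \<open>Base-4 digits and integer cycles\<close>

text \<open>The binary digits of \<open>n\<close> are read in base 4 (the Moser-de Bruijn sequence).
  This indexes the digit sums by natural numbers, and halving the index deletes the lowest
  digit.\<close>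

fun base4 :: "nat \<Rightarrow> nat" where
  "base4 n = (if n = 0 then 0 else 4 * base4 (n div 2) + n mod 2)"

declare base4.simps [simp del]

lemma base4_0 [simp]: "base4 0 = 0"
  by (simp add: base4.simps)

lemma base4_double_add: "e < 2 \<Longrightarrow> base4 (2 * n + e) = 4 * base4 n + e"
  by (cases "n = 0 \<and> e = 0") (auto simp: base4.simps[of "2 * n + e"])

lemma base4_double: "base4 (2 * n) = 4 * base4 n"
  using base4_double_add[of 0 n] by simp

lemma base4_Suc_double: "base4 (Suc (2 * n)) = Suc (4 * base4 n)"
  using base4_double_add[of 1 n] by simp

lemma base4_split: "base4 n = 4 * base4 (n div 2) + n mod 2"
  using base4_double_add[of "n mod 2" "n div 2"] by simp

lemma digit_sum_in_range_base4:
  assumes "\<And>j. d j \<in> {0, 1::nat}"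
  shows "(\<Sum>j<n. d j * 4 ^ j) \<in> range base4"
  using assms
proof (induction n arbitrary: d)
  case 0
  show ?case by (auto intro!: image_eqI[of _ _ 0])
next
  case (Suc n)
  from Suc.IH[of "\<lambda>j. d (Suc j)"] Suc.prems
  obtain k where k: "(\<Sum>j<n. d (Suc j) * 4 ^ j) = base4 k" by blast
  have "(\<Sum>j<Suc n. d j * 4 ^ j) = 4 * (\<Sum>j<n. d (Suc j) * 4 ^ j) + d 0"
    unfolding sum.lessThan_Suc_shift by (simp add: sum_distrib_left algebra_simps)
  also have "\<dots> = base4 (2 * k + d 0)"
    using Suc.prems[of 0] by (subst base4_double_add) (auto simp: k)
  finally show ?case by blast
qed

lemma base4_digits:
  "\<exists>n d. (\<forall>j. d j \<in> {0, 1::nat}) \<and> (\<forall>j\<ge>n. d j = 0) \<and> base4 k = (\<Sum>j<n. d j * 4 ^ j)"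
proof (induction k rule: less_induct)
  case (less k)
  show ?case
  proof (cases "k = 0")
    case True
    then show ?thesis by (intro exI[of _ 0] exI[of _ "\<lambda>_. 0"]) auto
  next
    case False
    then obtain n d where nd: "\<And>j. d j \<in> {0, 1::nat}" "\<And>j. j \<ge> n \<Longrightarrow> d j = 0"
      "base4 (k div 2) = (\<Sum>j<n. d j * 4 ^ j)"
      using less.IH[of "k div 2"] by auto
    define d' where "d' = case_nat (k mod 2) d"
    have "base4 k = (\<Sum>j<Suc n. d' j * 4 ^ j)"
      unfolding sum.lessThan_Suc_shift base4_split[of k] nd(3)
      by (simp add: d'_def sum_distrib_left algebra_simps)
    moreover have "d' j \<in> {0, 1}" for j
      using nd(1) by (auto simp: d'_def split: nat.split)
    moreover have "d' j = 0" if "j \<ge> Suc n" for j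
      using nd(2) that by (auto simp: d'_def split: nat.split)
    ultimately show ?thesis by blast
  qed
qed

text \<open>Only finitely many digits are nonzero, so the series in \<open>Lambda4\<close> is a
  finite sum. Sums over the spectrum can then be written as series indexed by
  \<open>nat\<close>.\<close>

lemma Lambda4_eq_range: "Lambda4 = range (\<lambda>k. real (base4 k))"
proof (intro equalityI subsetI)
  fix x assume "x \<in> Lambda4"
  then obtain d :: "nat \<Rightarrow> nat" where d: "x = (\<Sum>j. real (d j) * 4 ^ j)"
    "\<And>j. d j \<in> {0, 1}" "finite {j. d j \<noteq> 0}"
    unfolding Lambda4_def by blast
  from d(3) obtain n where n: "\<And>j. d j \<noteq> 0 \<Longrightarrow> j < n"
    by (auto simp: finite_nat_set_iff_bounded)
  have "x = (\<Sum>j<n. real (d j) * 4 ^ j)"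
    unfolding d(1) using n by (intro suminf_finite) auto
  also have "\<dots> = real (\<Sum>j<n. d j * 4 ^ j)" by simp
  finally have x: "x = real (\<Sum>j<n. d j * 4 ^ j)" .
  obtain k where "(\<Sum>j<n. d j * 4 ^ j) = base4 k"
    using digit_sum_in_range_base4[of d n, OF d(2)] by blast
  then show "x \<in> range (\<lambda>k. real (base4 k))"
    unfolding x by simp
next
  fix x assume "x \<in> range (\<lambda>k. real (base4 k))"
  then obtain k where k: "x = real (base4 k)" by blast
  obtain n d where nd: "\<And>j. d j \<in> {0, 1::nat}" "\<And>j. j \<ge> n \<Longrightarrow> d j = 0"
      "base4 k = (\<Sum>j<n. d j * 4 ^ j)"
    using base4_digits[of k] by blast
  have fin: "finite {j. d j \<noteq> 0}"
  proof (rule finite_subset)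
    show "{j. d j \<noteq> 0} \<subseteq> {..<n}"
    proof
      fix j assume "j \<in> {j. d j \<noteq> 0}"
      then show "j \<in> {..<n}" using nd(2)[of j] by (cases "j < n") auto
    qed
  qed simp
  have "(\<Sum>j. real (d j) * 4 ^ j) = (\<Sum>j<n. real (d j) * 4 ^ j)"
    by (intro suminf_finite) (auto intro: nd(2))
  then have "x = (\<Sum>j. real (d j) * 4 ^ j)"
    by (simp add: k nd(3))
  then show "x \<in> Lambda4"
    unfolding Lambda4_def by (intro CollectI exI[of _ d] conjI allI nd(1) fin)
qed

text \<open>Common low digits are stripped, each giving a factor 4; at the first place where the
  binary digits differ, the remaining difference is odd. An odd multiple keeps this form, which is
  that of the zeros of \<open>energy4\<close> in \<open>energy4_eq_0\<close>.\<close>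

lemma base4_diff:
  assumes "k \<noteq> l"
  shows "\<exists>n c. odd c \<and> int (base4 k) - int (base4 l) = 4 ^ n * c"
  using assms
proof (induction "k + l" arbitrary: k l rule: less_induct)
  case less
  have *: "int (base4 k) - int (base4 l)
    = 4 * (int (base4 (k div 2)) - int (base4 (l div 2))) + (int (k mod 2) - int (l mod 2))"
    unfolding base4_split[of k] base4_split[of l] by simp
  show ?case
  proof (cases "k mod 2 = l mod 2")
    case True
    with less.prems have "k div 2 \<noteq> l div 2" by (metis div_mult_mod_eq)
    moreover have "k div 2 + l div 2 < k + l" using less.prems by linarith
    ultimately obtain n c where nc: "odd c"
      "int (base4 (k div 2)) - int (base4 (l div 2)) = 4 ^ n * c"
      using less.hyps by blast
    with * True show ?thesis by (intro exI[of _ "Suc n"] exI[of _ c]) auto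
  next
    case False
    then have "k mod 2 = 0 \<and> l mod 2 = 1 \<or> k mod 2 = 1 \<and> l mod 2 = 0" by auto
    then have "odd (int (base4 k) - int (base4 l))"
      unfolding * by (elim disjE conjE) (simp_all only: even_add even_mult_iff, simp_all)
    then show ?thesis
      by (intro exI[of _ "0::nat"] exI[of _ "int (base4 k) - int (base4 l)"]) (simp only: power_0 mult_1 simp_thms)
  qed
qed

text \<open>The equation says that \<open>x\<close> is fixed by a composition of \<open>N\<close> of the maps \<open>y \<mapsto> (y + K d) / 4\<close>,
  \<open>d \<in> {0, 1}\<close>; the whole orbit then consists of integers.\<close>

definition cycle_point :: "int \<Rightarrow> int \<Rightarrow> bool" where
  "cycle_point K x \<longleftrightarrow> x \<noteq> 0 \<and> (\<exists>N>0. \<exists>d :: nat \<Rightarrow> int. (\<forall>j<N. d j \<in> {0, 1}) \<and>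
     K * (\<Sum>j<N. d j * 4 ^ j) = (4 ^ N - 1) * x)"

text \<open>Rotating the digit word by one place passes to the next point of the same cycle.\<close>

lemma cycle_point_step:
  assumes "cycle_point K x" "odd K"
  obtains x' e where "cycle_point K x'" "e \<in> {0, 1}" "x + K * e = 4 * x'"
proof -
  obtain N d where N: "N > 0" and d: "\<And>j. j < N \<Longrightarrow> d j \<in> {0, 1::int}"
    and eq: "K * (\<Sum>j<N. d j * 4 ^ j) = (4 ^ N - 1) * x" and x: "x \<noteq> 0"
    using assms(1) unfolding cycle_point_def by blast
  obtain n where n: "N = Suc n" using N by (cases N) auto
  define s where "s = (\<Sum>j<n. d (Suc j) * 4 ^ j)"
  have sum: "(\<Sum>j<N. d j * 4 ^ j) = d 0 + 4 * s"
    unfolding n sum.lessThan_Suc_shift s_def by (simp add: sum_distrib_left algebra_simps)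
  have eq1: "K * (d 0 + 4 * s) = (4 ^ N - 1) * x"
    using eq by (simp only: sum)
  \<comment> \<open>Solving \<open>eq1\<close> for \<open>x + K * d 0\<close> gives four times this
    integer, so divisibility by 4 comes for free.\<close>
  define x' where "x' = 4 ^ n * x - K * s"
  have x': "x + K * d 0 = 4 * x'"
    using eq1 by (simp add: x'_def n algebra_simps)
  \<comment> \<open>The lowest digit moves to the top position \<open>n\<close>.\<close>
  define d' where "d' j = (if j = n then d 0 else d (Suc j))" for j
  have sum': "(\<Sum>j<N. d' j * 4 ^ j) = s + d 0 * 4 ^ n"
    unfolding n s_def d'_def by simp
  have "4 * (K * (s + d 0 * 4 ^ n)) = 4 * ((4 ^ N - 1) * x')"
  proof -
    have "4 * ((4 ^ N - 1) * x') = (4 ^ N - 1) * (x + K * d 0)"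
      unfolding x' by simp
    also have "\<dots> = K * (d 0 + 4 * s) + (4 ^ N - 1) * (K * d 0)"
      using eq1 by (simp add: algebra_simps)
    finally show ?thesis unfolding n by (simp add: algebra_simps)
  qed
  then have eq': "K * (\<Sum>j<N. d' j * 4 ^ j) = (4 ^ N - 1) * x'"
    unfolding sum' by simp
  have d': "d' j \<in> {0, 1}" if "j < N" for j
    using d that unfolding d'_def n by auto
  \<comment> \<open>If the next point were 0, all digits would vanish, being nonnegative with
    weighted sum 0, and then \<open>x\<close> itself would be 0.\<close>
  have "x' \<noteq> 0"
  proof
    assume "x' = 0"
    with eq' have "(\<Sum>j<N. d' j * 4 ^ j) = 0" using assms(2) by auto
    then have "\<forall>j\<in>{..<N}. d' j * 4 ^ j = 0"
      by (subst (asm) sum_nonneg_eq_0_iff) (use d' in force)+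
    then have "d' n * 4 ^ n = 0" using n by blast
    then have "d 0 = 0" by (simp add: d'_def)
    with x' x \<open>x' = 0\<close> show False by simp
  qed
  then have "cycle_point K x'"
    unfolding cycle_point_def using N d' eq' by blast
  with d[of 0] N x' that show ?thesis by blast
qed

text \<open>The digits of \<open>k\<close> are compared with those of the cycle. Agreement takes out
  a factor 4 and leaves \<open>k div 2\<close> with the next cycle point; the first disagreement
  leaves an odd number, as \<open>K\<close> is odd. Thus the frequencies translated by
  \<open>x\<close> are all zeros of \<open>energy4\<close>.\<close>

lemma cycle_point_add_base4:
  assumes "cycle_point K x" "odd K"
  shows "\<exists>n c. odd c \<and> x + K * int (base4 k) = 4 ^ n * c"
  using assms(1)
\<comment> \<open>Lexicographic descent: \<open>k\<close> decreases until it is 0; from then on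
  agreement forces the digit 0, so \<open>x = 4 * x'\<close> and the absolute value of the nonzero
  \<open>x\<close> decreases.\<close>
proof (induction "(k, x)" arbitrary: k x rule: wf_induct_rule[OF wf_measures[of "[fst, nat \<circ> abs \<circ> snd]"]])
  case (1 k x)
  obtain x' e where x': "cycle_point K x'" "e \<in> {0, 1}" "x + K * e = 4 * x'"
    using cycle_point_step[OF 1(2) assms(2)] by blast
  have *: "x + K * int (base4 k) = 4 * (x' + K * int (base4 (k div 2))) + K * (int (k mod 2) - e)"
    using x'(3) unfolding base4_split[of k] by (simp add: algebra_simps)
  show ?case
  proof (cases "int (k mod 2) = e")
    case True
    have "x \<noteq> 0" using 1(2) by (simp add: cycle_point_def)
    have "((k div 2, x'), (k, x)) \<in> measures [fst, nat \<circ> abs \<circ> snd]"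
    proof (cases "k = 0")
      case k: True
      with True x'(3) have "x = 4 * x'" by simp
      with k \<open>x \<noteq> 0\<close> show ?thesis by auto
    qed auto
    then obtain n c where "odd c" "x' + K * int (base4 (k div 2)) = 4 ^ n * c"
      using 1(1) x'(1) by blast
    with * True show ?thesis by (intro exI[of _ "Suc n"] exI[of _ c]) auto
  next
    case False
    then have "odd (int (k mod 2) - e)" using x'(2) by auto
    then have "odd (x + K * int (base4 k))" unfolding * using assms(2) by simp
    then show ?thesis
      by (intro exI[of _ "0::nat"] exI[of _ "x + K * int (base4 k)"]) (simp only: power_0 mult_1 simp_thms)
  qed
qed

subsection \<open>The Fourier transform of the Bernoulli convolution\<close>

abbreviation \<mu>4 :: "real measure" where
  "\<mu>4 \<equiv> bernoulli_convolution4"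

interpretation mu4: real_distribution \<mu>4
  using prob_space_bernoulli_convolution4
  by (simp add: real_distribution_def real_distribution_axioms_def)

lemma expo_measurable [measurable]: "expo t \<in> borel_measurable borel"
  unfolding expo_def[abs_def] by measurable

lemma norm_expo [simp]: "cmod (expo t x) = 1"
  using norm_exp_i_times[of "- 2 * pi * t * x"]
  by (simp add: expo_def mult_ac)

lemma expo_0 [simp]: "expo 0 x = 1"
  by (simp add: expo_def)

lemma cnj_expo: "cnj (expo t x) = expo (- t) x"
  by (simp add: expo_def exp_cnj)

lemma expo_mult: "expo s x * expo t x = expo (s + t) x"
  by (simp add: expo_def exp_add[symmetric] algebra_simps)

lemma integrable_expo [simp]: "integrable \<mu>4 (expo t)"
  by (rule mu4.integrable_const_bound[where B=1]) auto

definition fourier4 :: "real \<Rightarrow> complex" where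
  "fourier4 t = (LINT x|\<mu>4. expo t x)"

lemma fourier4_char: "fourier4 t = char \<mu>4 (- 2 * pi * t)"
  by (simp add: fourier4_def char_def expo_def mult_ac)

lemma fourier4_0 [simp]: "fourier4 0 = 1"
  by (simp add: fourier4_char mu4.char_zero)

lemma fourier4_uminus: "fourier4 (- t) = cnj (fourier4 t)"
  by (simp add: fourier4_def cnj_expo[symmetric])

definition energy4 :: "real \<Rightarrow> real" where
  "energy4 t = (cmod (fourier4 t))\<^sup>2"

text \<open>By the half-angle formula this is cos^2(pi t / 2); the form linear in the cosine makes
  integer shifts easy to follow.\<close>

definition weight :: "real \<Rightarrow> real" where
  "weight t = (1 + cos (pi * t)) / 2"

lemma energy4_nonneg [simp]: "energy4 t \<ge> 0"
  by (simp add: energy4_def)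

lemma energy4_0 [simp]: "energy4 0 = 1"
  by (simp add: energy4_def)

lemma energy4_uminus [simp]: "energy4 (- t) = energy4 t"
  by (simp add: energy4_def fourier4_uminus)

lemma isCont_energy4: "isCont energy4 t"
  unfolding energy4_def[abs_def] fourier4_char[abs_def]
  by (intro continuous_intros isCont_o2[OF _ mu4.isCont_char])

text \<open>Self-similarity on the Fourier side: averaging the two translates contributes the factor
  (1 + exp(-i pi t)) / 2, whose squared modulus is \<open>weight t\<close>.\<close>

lemma energy4_rescale: "energy4 t = weight t * energy4 (t / 4)"
proof -
  have "fourier4 t = (1 + iexp (- (pi * t))) / 2 * fourier4 (t / 4)"
    unfolding fourier4_char
    by (subst bc_invariant_char[OF prob_space_bernoulli_convolution4 sets_bernoulli_convolution4
          bc_invariant_bernoulli_convolution4]) simp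
  moreover have "(cmod ((1 + iexp (- (pi * t))) / 2))\<^sup>2 = weight t"
  proof -
    have "1 + iexp (- (pi * t)) = Complex (1 + cos (pi * t)) (- sin (pi * t))"
      by (simp add: complex_eq_iff Re_exp Im_exp)
    then have "(cmod ((1 + iexp (- (pi * t))) / 2))\<^sup>2 = ((1 + cos (pi * t))\<^sup>2 + (sin (pi * t))\<^sup>2) / 4"
      by (simp add: norm_divide power_divide cmod_power2)
    also have "\<dots> = weight t"
      unfolding weight_def by (simp add: sin_squared_eq power2_eq_square field_simps)
    finally show ?thesis .
  qed
  ultimately show ?thesis
    by (simp only: energy4_def norm_mult power_mult_distrib)
qed

lemma weight_nonneg [simp]: "weight t \<ge> 0"
proof -
  have "0 \<le> 1 + cos (pi * t)" using cos_ge_minus_one[of "pi * t"] by linarith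
  then show ?thesis by (simp add: weight_def)
qed

text \<open>An odd shift changes the sign of the cosine and so exchanges the two weights of the
  transfer operator.\<close>

lemma weight_add_int: "weight (t + real_of_int n) = (if even n then weight t else 1 - weight t)"
proof -
  have "cos (pi * t + pi * real_of_int n) = (if even n then cos (pi * t) else - cos (pi * t))"
    by (simp add: cos_add)
  then show ?thesis by (simp add: weight_def algebra_simps add_divide_distrib[symmetric])
qed

lemma weight_int: "weight (real_of_int n) = (if even n then 1 else 0)"
  using weight_add_int[of 0 n] by (simp add: weight_def)

lemma weight_eq_0_imp_odd:
  assumes "weight t = 0"
  shows "\<exists>n. odd n \<and> t = real_of_int n"
proof -
  have c: "cos (pi * t) = - 1" using assms by (simp add: weight_def)
  then have "sin (pi * t) = 0"
    using sin_cos_squared_add[of "pi * t"] by simp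
  then obtain n where "pi * t = real_of_int n * pi"
    by (auto simp: sin_zero_iff_int2)
  then have t: "t = real_of_int n" by simp
  moreover have "odd n"
    using assms weight_int[of n] unfolding t by (auto split: if_splits)
  ultimately show ?thesis by blast
qed

text \<open>\<open>weight\<close> vanishes at odd integers, and each use of
  \<open>energy4_rescale\<close> strips one factor 4 until the odd integer is reached.\<close>

lemma energy4_eq_0:
  assumes "odd c"
  shows "energy4 (4 ^ n * real_of_int c) = 0"
proof (induction n)
  case 0
  show ?case using assms by (subst energy4_rescale) (simp add: weight_int)
next
  case (Suc n)
  then show ?case by (subst energy4_rescale) simp
qed

section \<open>Orthogonal expansions and Bessel's inequality\<close>

lemma fourier4_eq_0_iff: "fourier4 t = 0 \<longleftrightarrow> energy4 t = 0"
  by (simp add: energy4_def)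

text \<open>When the square is expanded, orthogonality removes the off-diagonal terms. The
  coefficients stay arbitrary because the result serves both the projection and, for
  non-completeness, every competing combination.\<close>

lemma expo_dist_sq:
  assumes "finite F" and orth: "\<And>k l. k \<in> F \<Longrightarrow> l \<in> F \<Longrightarrow> k \<noteq> l \<Longrightarrow> fourier4 (k - l) = 0"
  shows "(LINT x|\<mu>4. (cmod (expo t x - (\<Sum>l\<in>F. c l * expo l x)))\<^sup>2)
    = 1 - 2 * (\<Sum>l\<in>F. Re (cnj (c l) * fourier4 (t - l))) + (\<Sum>l\<in>F. (cmod (c l))\<^sup>2)"
proof -
  let ?S = "\<lambda>x. \<Sum>l\<in>F. c l * expo l x"
  \<comment> \<open>The squared modulus becomes a product with the conjugate, so that integration
    produces only values of \<open>fourier4\<close>; real parts are taken at the end.\<close>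
  have pt: "complex_of_real ((cmod (expo t x - ?S x))\<^sup>2)
    = 1 - (\<Sum>l\<in>F. cnj (c l) * expo (t - l) x) - (\<Sum>l\<in>F. c l * expo (l - t) x)
      + (\<Sum>k\<in>F. \<Sum>l\<in>F. c k * cnj (c l) * expo (k - l) x)" for x
  proof -
    have "complex_of_real ((cmod (expo t x - ?S x))\<^sup>2)
      = (expo t x - ?S x) * (expo (- t) x - (\<Sum>l\<in>F. cnj (c l) * expo (- l) x))"
      by (simp only: complex_norm_square complex_cnj_diff cnj_sum complex_cnj_mult cnj_expo)
    also have "\<dots> = expo t x * expo (- t) x - expo t x * (\<Sum>l\<in>F. cnj (c l) * expo (- l) x)
        - ?S x * expo (- t) x + ?S x * (\<Sum>l\<in>F. cnj (c l) * expo (- l) x)"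
      by (simp only: algebra_simps)
    also have "expo t x * (\<Sum>l\<in>F. cnj (c l) * expo (- l) x) = (\<Sum>l\<in>F. cnj (c l) * (expo t x * expo (- l) x))"
      by (simp add: sum_distrib_left mult_ac)
    also have "?S x * expo (- t) x = (\<Sum>l\<in>F. c l * (expo l x * expo (- t) x))"
      by (simp only: sum_distrib_right mult.assoc)
    also have "?S x * (\<Sum>l\<in>F. cnj (c l) * expo (- l) x)
        = (\<Sum>k\<in>F. \<Sum>l\<in>F. c k * cnj (c l) * (expo k x * expo (- l) x))"
      unfolding sum_product by (intro sum.cong refl) (simp add: mult_ac)
    finally show ?thesis by (simp add: expo_mult)
  qed
  have "complex_of_real (LINT x|\<mu>4. (cmod (expo t x - ?S x))\<^sup>2)
    = (LINT x|\<mu>4. complex_of_real ((cmod (expo t x - ?S x))\<^sup>2))"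
    by (simp only: integral_complex_of_real)
  also have "\<dots> = 1 - (\<Sum>l\<in>F. cnj (c l) * fourier4 (t - l)) - (\<Sum>l\<in>F. c l * fourier4 (l - t))
      + (\<Sum>k\<in>F. \<Sum>l\<in>F. c k * cnj (c l) * fourier4 (k - l))"
    unfolding pt using mu4.prob_space by (simp add: fourier4_def)
  also have "(\<Sum>k\<in>F. \<Sum>l\<in>F. c k * cnj (c l) * fourier4 (k - l)) = (\<Sum>k\<in>F. complex_of_real ((cmod (c k))\<^sup>2))"
  proof (rule sum.cong[OF refl])
    fix k assume k: "k \<in> F"
    have "(\<Sum>l\<in>F. c k * cnj (c l) * fourier4 (k - l)) = (\<Sum>l\<in>F. if l = k then c k * cnj (c k) else 0)"
      using orth k by (intro sum.cong) auto
    also have "\<dots> = complex_of_real ((cmod (c k))\<^sup>2)"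
      using k assms(1) by (simp only: complex_norm_square sum.delta if_True)
    finally show "(\<Sum>l\<in>F. c k * cnj (c l) * fourier4 (k - l)) = complex_of_real ((cmod (c k))\<^sup>2)" .
  qed
  \<comment> \<open>The second linear sum is the conjugate of the first, so the two together give
    twice a real part.\<close>
  also have "(\<Sum>l\<in>F. c l * fourier4 (l - t)) = cnj (\<Sum>l\<in>F. cnj (c l) * fourier4 (t - l))"
    using fourier4_uminus[of "t - l" for l] by simp
  finally have "Re (complex_of_real (LINT x|\<mu>4. (cmod (expo t x - ?S x))\<^sup>2))
    = Re (1 - (\<Sum>l\<in>F. cnj (c l) * fourier4 (t - l)) - cnj (\<Sum>l\<in>F. cnj (c l) * fourier4 (t - l))
      + (\<Sum>k\<in>F. complex_of_real ((cmod (c k))\<^sup>2)))"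
    by (rule arg_cong)
  then show ?thesis
    by (simp del: of_real_power)
qed

text \<open>With Fourier coefficients as \<open>c\<close>, the linear and the quadratic sum both
  consist of values of \<open>energy4\<close>, and one copy survives with a minus sign.
  Nonnegativity of the left side then yields Bessel's inequality.\<close>

lemma expo_dist_sq_projection:
  assumes "finite F" and orth: "\<And>k l. k \<in> F \<Longrightarrow> l \<in> F \<Longrightarrow> k \<noteq> l \<Longrightarrow> fourier4 (k - l) = 0"
  shows "(LINT x|\<mu>4. (cmod (expo t x - (\<Sum>l\<in>F. fourier4 (t - l) * expo l x)))\<^sup>2)
    = 1 - (\<Sum>l\<in>F. energy4 (t - l))"
proof -
  have "Re (cnj z * z) = (cmod z)\<^sup>2" for z
    by (metis complex_norm_square mult.commute Re_complex_of_real)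
  then show ?thesis
    by (subst expo_dist_sq[OF assms]) (simp_all add: energy4_def)
qed

lemma bessel_energy4:
  assumes "finite F" and "\<And>k l. k \<in> F \<Longrightarrow> l \<in> F \<Longrightarrow> k \<noteq> l \<Longrightarrow> fourier4 (k - l) = 0"
  shows "(\<Sum>l\<in>F. energy4 (t - l)) \<le> 1"
proof -
  have "0 \<le> (LINT x|\<mu>4. (cmod (expo t x - (\<Sum>l\<in>F. fourier4 (t - l) * expo l x)))\<^sup>2)"
    by simp
  then show ?thesis using expo_dist_sq_projection[OF assms] by simp
qed

subsection \<open>The spectral sum\<close>

definition freq :: "int \<Rightarrow> nat \<Rightarrow> real" where
  "freq K k = real_of_int (K * int (base4 k))"

lemma freq_0 [simp]: "freq K 0 = 0"
  by (simp add: freq_def)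

lemma fourier4_freq_diff:
  assumes "odd K" "k \<noteq> l"
  shows "fourier4 (freq K k - freq K l) = 0"
proof -
  obtain n c where nc: "odd c" "int (base4 k) - int (base4 l) = 4 ^ n * c"
    using base4_diff[OF assms(2)] by blast
  have "freq K k - freq K l = real_of_int (K * (int (base4 k) - int (base4 l)))"
    by (simp add: freq_def right_diff_distrib)
  also have "\<dots> = 4 ^ n * real_of_int (K * c)"
    unfolding nc(2) by simp
  finally show ?thesis
    using energy4_eq_0[of "K * c" n] assms(1) nc(1) by (simp add: fourier4_eq_0_iff)
qed

lemma fourier4_range_freq_diff:
  assumes "odd K" "k \<in> range (freq K)" "l \<in> range (freq K)" "k \<noteq> l"
  shows "fourier4 (k - l) = 0"
  using assms fourier4_freq_diff[OF assms(1)] by (metis imageE)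

text \<open>Equal frequencies at distinct indices would force \<open>fourier4 0 = 0\<close>, whereas
  that value is 1.\<close>

lemma inj_freq:
  assumes "odd K"
  shows "inj (freq K)"
proof (rule injI, rule ccontr)
  fix k l assume "freq K k = freq K l" "k \<noteq> l"
  then show False using fourier4_freq_diff[OF assms \<open>k \<noteq> l\<close>] by simp
qed

text \<open>This is the function \<open>Q\<close>. For odd \<open>K\<close> Bessel's inequality
  bounds the partial sums, so the series converges and \<open>suminf\<close> takes no default
  value.\<close>

definition spectral_sum :: "int \<Rightarrow> real \<Rightarrow> real" where
  "spectral_sum K t = (\<Sum>k. energy4 (t + freq K k))"

text \<open>Bessel's inequality is applied at the frequency \<open>- t\<close>; evenness of
  \<open>energy4\<close> accounts for the sign.\<close>

lemma spectral_partial_sum_le_1: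
  assumes "odd K" "finite A"
  shows "(\<Sum>k\<in>A. energy4 (t + freq K k)) \<le> 1"
proof -
  have "(\<Sum>k\<in>A. energy4 (t + freq K k)) = (\<Sum>k\<in>A. energy4 (- t - freq K k))"
    using energy4_uminus[of "t + freq K k" for k] by (simp only: minus_add_distrib diff_conv_add_uminus)
  also have "\<dots> = (\<Sum>l\<in>freq K ` A. energy4 (- t - l))"
    using inj_on_subset[OF inj_freq[OF assms(1)]] by (subst sum.reindex) auto
  also have "\<dots> \<le> 1"
    using assms by (intro bessel_energy4 fourier4_range_freq_diff[OF assms(1)]) auto
  finally show ?thesis .
qed

lemma summable_spectral_sum:
  assumes "odd K"
  shows "summable (\<lambda>k. energy4 (t + freq K k))"
  by (rule summableI_nonneg_bounded[of _ 1]) (use spectral_partial_sum_le_1[OF assms] in auto)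

lemma sum_le_spectral_sum:
  assumes "odd K" "finite A"
  shows "(\<Sum>k\<in>A. energy4 (t + freq K k)) \<le> spectral_sum K t"
  unfolding spectral_sum_def using assms summable_spectral_sum[OF assms(1)]
  by (intro sum_le_suminf) auto

lemma spectral_sum_le_1: "odd K \<Longrightarrow> spectral_sum K t \<le> 1"
  unfolding spectral_sum_def
  by (intro suminf_le_const summable_spectral_sum spectral_partial_sum_le_1) auto

lemma energy4_le_spectral_sum: "odd K \<Longrightarrow> energy4 t \<le> spectral_sum K t"
  using sum_le_spectral_sum[of K "{0}" t] by simp

section \<open>The transfer operator and minimizers\<close>

lemma sum_lessThan_double:
  fixes f :: "nat \<Rightarrow> 'a::comm_monoid_add"
  shows "(\<Sum>k<2 * n. f k) = (\<Sum>k<n. f (2 * k)) + (\<Sum>k<n. f (Suc (2 * k)))"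
  by (induction n) (simp_all add: ac_simps)

text \<open>Even and odd indices are the frequencies with lowest digit 0 and 1. The former are
  multiples of 4 and leave the weight at \<open>t\<close> unchanged; the latter add the odd number
  \<open>K\<close> as well and so flip it.\<close>

lemma spectral_sum_rescale:
  assumes "odd K"
  shows "spectral_sum K t = weight t * spectral_sum K (t / 4)
    + (1 - weight t) * spectral_sum K ((t + real_of_int K) / 4)"
proof -
  let ?S = "\<lambda>n t. \<Sum>k<n. energy4 (t + freq K k)"
  have lim: "(\<lambda>n. ?S n t) \<longlonglongrightarrow> spectral_sum K t" for t
    unfolding spectral_sum_def by (rule summable_LIMSEQ[OF summable_spectral_sum[OF assms]])
  have even: "energy4 (t + freq K (2 * k)) = weight t * energy4 (t / 4 + freq K k)" for k
  proof -
    have "weight (t + freq K (2 * k)) = weight t"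
      unfolding freq_def by (subst weight_add_int) (simp add: base4_double)
    then show ?thesis
      by (subst energy4_rescale) (simp add: freq_def base4_double add_divide_distrib)
  qed
  have odd: "energy4 (t + freq K (Suc (2 * k))) = (1 - weight t) * energy4 ((t + real_of_int K) / 4 + freq K k)" for k
  proof -
    have "weight (t + freq K (Suc (2 * k))) = 1 - weight t"
      unfolding freq_def using assms by (subst weight_add_int) (simp add: base4_Suc_double)
    moreover have "(t + freq K (Suc (2 * k))) / 4 = (t + real_of_int K) / 4 + freq K k"
      by (simp only: freq_def base4_Suc_double) (simp add: field_simps)
    ultimately show ?thesis
      by (simp only: energy4_rescale[of "t + freq K (Suc (2 * k))"])
  qed
  have "?S (2 * n) t = weight t * ?S n (t / 4) + (1 - weight t) * ?S n ((t + real_of_int K) / 4)" for n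
    unfolding sum_lessThan_double even odd sum_distrib_left ..
  \<comment> \<open>The splitting is exact for partial sums of even length, so the limit is taken
    along \<open>2 * n\<close>.\<close>
  moreover have "(\<lambda>n. ?S (2 * n) t) \<longlonglongrightarrow> spectral_sum K t"
    using LIMSEQ_subseq_LIMSEQ[OF lim[of t], of "\<lambda>n. 2 * n"] by (simp add: strict_mono_def o_def)
  moreover have "(\<lambda>n. weight t * ?S n (t / 4) + (1 - weight t) * ?S n ((t + real_of_int K) / 4))
    \<longlonglongrightarrow> weight t * spectral_sum K (t / 4) + (1 - weight t) * spectral_sum K ((t + real_of_int K) / 4)"
    by (intro tendsto_intros lim)
  ultimately show ?thesis
    by (simp add: LIMSEQ_unique)
qed

text \<open>\<^const>\<open>spectral_sum\<close> is lower semicontinuous, being a supremum of continuous partial sums.\<close>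

lemma spectral_sum_attains_inf:
  assumes "odd K" "compact X" "X \<noteq> {}"
  obtains s where "s \<in> X" "\<And>u. u \<in> X \<Longrightarrow> spectral_sum K s \<le> spectral_sum K u"
proof -
  define m where "m = (INF u\<in>X. spectral_sum K u)"
  have nonneg: "0 \<le> spectral_sum K u" for u
    using energy4_le_spectral_sum[OF assms(1), of u] energy4_nonneg[of u] by linarith
  then have bdd: "bdd_below (spectral_sum K ` X)" by (intro bdd_belowI2[of _ 0])
  \<comment> \<open>A minimizing sequence: along a convergent subsequence the bound passes to each
    finite partial sum by continuity, and then to the whole series.\<close>
  have "\<exists>u\<in>X. spectral_sum K u < m + inverse (real (Suc n))" for n
    unfolding m_def using assms(3) bdd by (subst cINF_less_iff[symmetric]) auto
  then obtain u where u: "\<And>n. u n \<in> X" "\<And>n. spectral_sum K (u n) < m + inverse (real (Suc n))"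
    by metis
  obtain s r where s: "s \<in> X" "strict_mono r" "(u \<circ> r) \<longlonglongrightarrow> s"
    using assms(2) u(1) unfolding compact_def by blast
  have "(\<Sum>k<n. energy4 (s + freq K k)) \<le> m" for n
  proof (rule LIMSEQ_le)
    show "(\<lambda>i. \<Sum>k<n. energy4 ((u \<circ> r) i + freq K k)) \<longlonglongrightarrow> (\<Sum>k<n. energy4 (s + freq K k))"
      by (intro tendsto_sum isCont_tendsto_compose[OF isCont_energy4] tendsto_intros s(3))
    show "(\<lambda>i. m + inverse (real (Suc (r i)))) \<longlonglongrightarrow> m"
      using tendsto_add[OF tendsto_const LIMSEQ_subseq_LIMSEQ[OF LIMSEQ_inverse_real_of_nat s(2)], of m]
      by (simp add: o_def)
    show "\<exists>N. \<forall>i\<ge>N. (\<Sum>k<n. energy4 ((u \<circ> r) i + freq K k)) \<le> m + inverse (real (Suc (r i)))"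
      using sum_le_spectral_sum[OF assms(1), of "{..<n}"] u(2)
      by (intro exI[of _ 0] allI impI) (auto intro: order_trans[OF _ less_imp_le])
  qed
  then have "spectral_sum K s \<le> m"
    unfolding spectral_sum_def by (intro suminf_le_const summable_spectral_sum[OF assms(1)])
  moreover have "m \<le> spectral_sum K v" if "v \<in> X" for v
    unfolding m_def using bdd that by (rule cINF_lower)
  ultimately show ?thesis using that s(1) order_trans by blast
qed

section \<open>Cycles of integer minimizers\<close>

lemma finite_self_map_cycle:
  assumes "finite Z" "z \<in> Z" "f ` Z \<subseteq> Z"
  obtains w N where "w \<in> Z" "N > 0" "(f ^^ N) w = w"
proof -
  have inZ: "(f ^^ n) z \<in> Z" for n
    by (induction n) (use assms in auto)
  \<comment> \<open>Pigeonhole: the orbit of \<open>z\<close> stays in the finite set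
    \<open>Z\<close>, so some value recurs and is periodic.\<close>
  have "\<not> inj (\<lambda>n. (f ^^ n) z)"
  proof
    assume "inj (\<lambda>n. (f ^^ n) z)"
    moreover have "finite (range (\<lambda>n. (f ^^ n) z))"
      by (rule finite_subset[OF _ assms(1)]) (use inZ in auto)
    ultimately show False using finite_imageD by blast
  qed
  then obtain i' j' where ij': "i' \<noteq> j'" "(f ^^ i') z = (f ^^ j') z"
    unfolding inj_def by blast
  define i j where "i = min i' j'" and "j = max i' j'"
  have ij: "i < j" "(f ^^ i) z = (f ^^ j) z"
    using ij' by (auto simp: i_def j_def min_def max_def)
  have "(f ^^ (j - i)) ((f ^^ i) z) = (f ^^ j) z"
    using funpow_add[of "j - i" i f] ij(1) by (simp add: fun_eq_iff)
  with ij show ?thesis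
    by (intro that[of "(f ^^ i) z" "j - i"]) (auto intro: inZ)
qed

text \<open>Iterating \<open>4 * f z = z + K * e\<close> telescopes into a base-4 digit sum; when
  the orbit closes up after \<open>N\<close> steps, this is the defining equation of
  \<open>cycle_point\<close>.\<close>

lemma cycle_pointI:
  fixes f :: "int \<Rightarrow> int"
  assumes step: "\<And>z. z \<in> Z \<Longrightarrow> f z \<in> Z \<and> (\<exists>e\<in>{0, 1}. 4 * f z = z + K * e)"
    and w: "w \<in> Z" "w \<noteq> 0" "N > 0" "(f ^^ N) w = w"
  shows "cycle_point K w"
proof -
  obtain e where e: "\<And>z. z \<in> Z \<Longrightarrow> e z \<in> {0, 1}" "\<And>z. z \<in> Z \<Longrightarrow> 4 * f z = z + K * e z"
    using step by metis
  have inZ: "(f ^^ n) w \<in> Z" for n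
    by (induction n) (use w step in auto)
  have "4 ^ n * (f ^^ n) w = w + K * (\<Sum>j<n. e ((f ^^ j) w) * 4 ^ j)" for n
  proof (induction n)
    case (Suc n)
    have "4 ^ Suc n * (f ^^ Suc n) w = 4 ^ n * (4 * f ((f ^^ n) w))" by simp
    also have "\<dots> = 4 ^ n * (f ^^ n) w + K * (e ((f ^^ n) w) * 4 ^ n)"
      unfolding e(2)[OF inZ] by (simp add: algebra_simps)
    finally show ?case unfolding Suc.IH by (simp add: algebra_simps)
  qed simp
  from this[of N] have eq: "K * (\<Sum>j<N. e ((f ^^ j) w) * 4 ^ j) = (4 ^ N - 1) * w"
    unfolding w(4) by (simp add: algebra_simps)
  show ?thesis
    unfolding cycle_point_def
    by (intro conjI exI[of _ N] exI[of _ "\<lambda>j. e ((f ^^ j) w)"] allI impI w(2,3) e(1)[OF inZ] eq)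
qed

lemma ex_cycle_point_if_spectral_sum_less_1:
  assumes K: "odd K" and less: "spectral_sum K t < 1"
  shows "\<exists>x. cycle_point K x"
proof -
  \<comment> \<open>Large enough for \<open>X\<close> to contain \<open>t\<close> and to be mapped
    into itself by both branches \<open>u / 4\<close> and \<open>(u + K) / 4\<close>.\<close>
  define M where "M = \<bar>t\<bar> + \<bar>real_of_int K\<bar>"
  define X where "X = {- M..M}"
  have "compact X" "X \<noteq> {}" by (auto simp: X_def M_def)
  then obtain s where s: "s \<in> X" and min: "\<And>u. u \<in> X \<Longrightarrow> spectral_sum K s \<le> spectral_sum K u"
    using spectral_sum_attains_inf[OF K] by blast
  define m where "m = spectral_sum K s"
  have "t \<in> X" unfolding X_def M_def atLeastAtMost_iff by linarith
  then have "m < 1" using min[of t] less by (simp add: m_def)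
  have X0: "u / 4 \<in> X" and X1: "(u + real_of_int K) / 4 \<in> X" if "u \<in> X" for u
    using that abs_ge_zero[of t] abs_ge_self[of "real_of_int K"] abs_ge_minus_self[of "real_of_int K"]
    unfolding X_def M_def atLeastAtMost_iff add_divide_distrib by argo+
  define Y where "Y = {u\<in>X. spectral_sum K u = m}"
  have Y_step: "(weight u > 0 \<longrightarrow> u / 4 \<in> Y) \<and> (weight u < 1 \<longrightarrow> (u + real_of_int K) / 4 \<in> Y)"
    if u: "u \<in> Y" for u
  proof -
    \<comment> \<open>These are the excesses over the minimum. Both are nonnegative and their
      weighted sum is 0, so a branch of positive weight leads to a minimizer again.\<close>
    let ?a = "spectral_sum K (u / 4) - m" and ?b = "spectral_sum K ((u + real_of_int K) / 4) - m"
    have ab: "?a \<ge> 0" "?b \<ge> 0" using u X0 X1 min by (auto simp: Y_def m_def)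
    have w: "0 \<le> weight u" "weight u \<le> 1"
      using weight_nonneg[of "u + real_of_int 1"] unfolding weight_add_int by auto
    have "weight u * ?a + (1 - weight u) * ?b = 0"
      using spectral_sum_rescale[OF K, of u] u by (simp add: Y_def algebra_simps)
    moreover have "0 \<le> weight u * ?a" "0 \<le> (1 - weight u) * ?b"
      using ab w by auto
    ultimately have "weight u * ?a = 0" "(1 - weight u) * ?b = 0" by linarith+
    then show ?thesis using u X0 X1 by (auto simp: Y_def)
  qed
  have Y_int: "\<exists>n. n \<noteq> 0 \<and> u = real_of_int n" if u: "u \<in> Y" for u
  proof -
    \<comment> \<open>Otherwise every \<open>u / 4 ^ i\<close> would be a minimizer, and continuity
      of \<open>energy4\<close> at 0, where its value is 1, would contradict
      \<open>m < 1\<close>.\<close>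
    have "\<exists>i. weight (u / 4 ^ i) = 0"
    proof (rule ccontr)
      assume "\<nexists>i. weight (u / 4 ^ i) = 0"
      then have pos: "weight (u / 4 ^ i) > 0" for i
        using weight_nonneg[of "u / 4 ^ i"] by (metis order_le_less)
      have "u / 4 ^ i \<in> Y" for i
      proof (induction i)
        case (Suc i)
        then show ?case using Y_step[of "u / 4 ^ i"] pos[of i] by (simp add: mult.commute)
      qed (use u in simp)
      then have "energy4 (u / 4 ^ i) \<le> m" for i
        using energy4_le_spectral_sum[OF K, of "u / 4 ^ i"] by (simp add: Y_def)
      moreover have "(\<lambda>i. u / 4 ^ i) \<longlonglongrightarrow> 0" by real_asymp
      then have "(\<lambda>i. energy4 (u / 4 ^ i)) \<longlonglongrightarrow> energy4 0"
        by (rule isCont_tendsto_compose[OF isCont_energy4])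
      ultimately have "energy4 0 \<le> m" by (intro LIMSEQ_le_const2) auto
      with \<open>m < 1\<close> show False by simp
    qed
    then obtain i n where "odd n" "u / 4 ^ i = real_of_int n"
      using weight_eq_0_imp_odd by blast
    then show ?thesis
      by (intro exI[of _ "4 ^ i * n"]) (auto simp: field_simps)
  qed
  define Z where "Z = {n. real_of_int n \<in> Y}"
  have Z_step: "\<exists>n'\<in>Z. \<exists>e\<in>{0, 1}. 4 * n' = n + K * e" if n: "n \<in> Z" for n
  proof -
    \<comment> \<open>At an integer one branch has weight 1 and the other 0. Parity selects the
      branch of weight 1; its value lies in \<open>Y\<close> and is therefore an integer.\<close>
    define e :: int where "e = (if even n then 0 else 1)"
    have "(real_of_int n + real_of_int K * real_of_int e) / 4 \<in> Y"
      using Y_step[of "real_of_int n"] n weight_int[of n] by (auto simp: Z_def e_def)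
    moreover from Y_int[OF this] obtain n' where
      n': "(real_of_int n + real_of_int K * real_of_int e) / 4 = real_of_int n'" by blast
    ultimately have "n' \<in> Z" by (simp add: Z_def)
    moreover have "real_of_int (4 * n') = real_of_int (n + K * e)" using n' by simp
    then have "4 * n' = n + K * e" by (simp only: of_int_eq_iff)
    moreover have "e \<in> {0, 1}" by (simp add: e_def)
    ultimately show ?thesis by blast
  qed
  then obtain f where f: "\<And>n. n \<in> Z \<Longrightarrow> f n \<in> Z \<and> (\<exists>e\<in>{0, 1}. 4 * f n = n + K * e)"
    by metis
  have "finite Z"
  proof (rule finite_subset)
    show "Z \<subseteq> {\<lceil>- M\<rceil>..\<lfloor>M\<rfloor>}"
      by (auto simp: Z_def Y_def X_def ceiling_le_iff le_floor_iff)
  qed simp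
  moreover have "s \<in> Y" using s by (simp add: Y_def m_def)
  then obtain z where "z \<in> Z" using Y_int by (auto simp: Z_def)
  ultimately obtain w N where w: "w \<in> Z" "N > 0" "(f ^^ N) w = w"
    using finite_self_map_cycle[of Z z f] f by blast
  moreover have "w \<noteq> 0" using Y_int[of "real_of_int w"] w(1) by (auto simp: Z_def)
  ultimately show ?thesis using cycle_pointI[OF f] by blast
qed

subsection \<open>Density of exponentials in the square integrable functions\<close>

lemma square_integrableD:
  assumes "square_integrable M f"
  shows "f \<in> borel_measurable M" "integrable M (\<lambda>x. (cmod (f x))\<^sup>2)"
  using assms by (auto simp: square_integrable_def)

text \<open>A substitute for the triangle inequality that avoids square roots of integrals; it
  follows from 2ab <= a^2 + b^2 and costs a factor 2.\<close>

lemma cmod_add_sq_le: "(cmod (a + b))\<^sup>2 \<le> 2 * (cmod a)\<^sup>2 + 2 * (cmod b)\<^sup>2"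
proof -
  have "(cmod (a + b))\<^sup>2 \<le> (cmod a + cmod b)\<^sup>2"
    by (intro power_mono norm_triangle_ineq) simp
  also have "\<dots> \<le> 2 * (cmod a)\<^sup>2 + 2 * (cmod b)\<^sup>2"
    using sum_squares_bound[of "cmod a" "cmod b"] by (simp add: power2_sum)
  finally show ?thesis .
qed

lemma square_integrable_add:
  assumes f: "square_integrable M f" and g: "square_integrable M g"
  shows "square_integrable M (\<lambda>x. f x + g x)"
proof -
  note [measurable] = square_integrableD(1)[OF f] square_integrableD(1)[OF g]
  have "integrable M (\<lambda>x. (cmod (f x + g x))\<^sup>2)"
  proof (rule Bochner_Integration.integrable_bound)
    show "integrable M (\<lambda>x. 2 * (cmod (f x))\<^sup>2 + 2 * (cmod (g x))\<^sup>2)"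
      using square_integrableD(2)[OF f] square_integrableD(2)[OF g] by simp
  qed (use cmod_add_sq_le in \<open>auto simp: abs_of_nonneg\<close>)
  then show ?thesis by (simp add: square_integrable_def)
qed

lemma square_integrable_cmult:
  assumes "square_integrable M f"
  shows "square_integrable M (\<lambda>x. c * f x)"
  using assms by (auto simp: square_integrable_def norm_mult power_mult_distrib)

lemma square_integrable_diff:
  assumes f: "square_integrable M f" and g: "square_integrable M g"
  shows "square_integrable M (\<lambda>x. f x - g x)"
  using square_integrable_add[OF f square_integrable_cmult[OF g, of "- 1"]] by simp

lemma integral_sq_add_le:
  assumes f: "square_integrable M f" and g: "square_integrable M g"
  shows "(LINT x|M. (cmod (f x + g x))\<^sup>2) \<le> 2 * (LINT x|M. (cmod (f x))\<^sup>2) + 2 * (LINT x|M. (cmod (g x))\<^sup>2)"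
proof -
  note f2 = square_integrableD(2)[OF f] and g2 = square_integrableD(2)[OF g]
  have "(LINT x|M. (cmod (f x + g x))\<^sup>2) \<le> (LINT x|M. 2 * (cmod (f x))\<^sup>2 + 2 * (cmod (g x))\<^sup>2)"
    using square_integrableD(2)[OF square_integrable_add[OF f g]] f2 g2
    by (intro integral_mono cmod_add_sq_le) auto
  then show ?thesis using f2 g2 by simp
qed

text \<open>The inductive form gives closure properties by rule induction, without merging finite
  index sets; \<open>expo_span_explicit\<close> recovers the sums that \<open>is_spectrum\<close>
  asks for.\<close>

inductive_set expo_span :: "real set \<Rightarrow> (real \<Rightarrow> complex) set" for L where
  zero: "(\<lambda>_. 0) \<in> expo_span L"
| step: "l \<in> L \<Longrightarrow> g \<in> expo_span L \<Longrightarrow> (\<lambda>x. c * expo l x + g x) \<in> expo_span L"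

lemma expo_span_add:
  assumes "f \<in> expo_span L" and g: "g \<in> expo_span L"
  shows "(\<lambda>x. f x + g x) \<in> expo_span L"
  using assms(1)
proof induction
  case (step l f c)
  then show ?case using expo_span.step[of l L "\<lambda>x. f x + g x" c] by (simp add: add.assoc)
qed (simp add: g)

lemma expo_span_cmult:
  assumes "f \<in> expo_span L"
  shows "(\<lambda>x. c * f x) \<in> expo_span L"
  using assms
proof induction
  case (step l f d)
  then show ?case using expo_span.step[of l L "\<lambda>x. c * f x" "c * d"] by (simp add: algebra_simps)
qed (simp add: expo_span.zero)

lemma expo_in_expo_span: "l \<in> L \<Longrightarrow> expo l \<in> expo_span L"
  using expo_span.step[OF _ expo_span.zero, of l L 1] by simp

lemma expo_span_sum:
  assumes "finite F" "F \<subseteq> L"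
  shows "(\<lambda>x. \<Sum>l\<in>F. c l * expo l x) \<in> expo_span L"
  using assms by (induction F) (auto intro: expo_span.intros)

text \<open>Frequencies add up under multiplication, so the span of all exponentials is an algebra,
  as Stone-Weierstrass requires.\<close>

lemma expo_span_mult:
  assumes "f \<in> expo_span UNIV" "g \<in> expo_span UNIV"
  shows "(\<lambda>x. f x * g x) \<in> expo_span UNIV"
  using assms(1)
proof induction
  case (step l f c)
  have "(\<lambda>x. expo l x * g x) \<in> expo_span UNIV"
    using assms(2)
  proof induction
    case (step k h d)
    show ?case
      using expo_span.step[OF UNIV_I step.IH, of d "l + k"]
      by (simp add: expo_mult[symmetric] algebra_simps)
  qed (simp add: expo_span.zero)
  from expo_span_add[OF expo_span_cmult[OF this, of c] step.IH] show ?case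
    by (simp add: algebra_simps)
qed (simp add: expo_span.zero)

lemma expo_span_explicit:
  assumes "g \<in> expo_span L"
  shows "\<exists>F c. finite F \<and> F \<subseteq> L \<and> g = (\<lambda>x. \<Sum>l\<in>F. c l * expo l x)"
  using assms
proof induction
  case zero
  show ?case by (intro exI[of _ "{}"]) simp
next
  case (step l g a)
  then obtain F c where Fc: "finite F" "F \<subseteq> L" "g = (\<lambda>x. \<Sum>l\<in>F. c l * expo l x)" by blast
  \<comment> \<open>The frequency \<open>l\<close> may already lie in \<open>F\<close>; its two
    coefficients are then added.\<close>
  define c' where "c' k = (if k = l then a else 0) + (if k \<in> F then c k else 0)" for k
  have "(\<Sum>k\<in>insert l F. c' k * expo k x) = a * expo l x + g x" for x
  proof -
    have "(\<Sum>k\<in>insert l F. c' k * expo k x)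
      = (\<Sum>k\<in>insert l F. if k = l then a * expo k x else 0) + (\<Sum>k\<in>insert l F. if k \<in> F then c k * expo k x else 0)"
      unfolding sum.distrib[symmetric] c'_def by (intro sum.cong) (auto simp: algebra_simps)
    also have "(\<Sum>k\<in>insert l F. if k \<in> F then c k * expo k x else 0) = (\<Sum>k\<in>F. c k * expo k x)"
      using Fc(1) by (intro sum.mono_neutral_cong_right) auto
    finally show ?thesis using Fc(1,3) by simp
  qed
  then show ?case
    using Fc(1,2) step.hyps(1) by (intro exI[of _ "insert l F"] exI[of _ c']) auto
qed

text \<open>Euler's formula uses two opposite frequencies. The sine serves as a real-valued function
  separating points below.\<close>

lemma sin_in_expo_span:
  "(\<lambda>x. complex_of_real (sin (a * x))) \<in> expo_span UNIV"
proof -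
  define t where "t = - a / (2 * pi)"
  have e: "expo t x = exp (\<i> * complex_of_real (a * x))" "expo (- t) x = exp (- (\<i> * complex_of_real (a * x)))" for x
    by (simp_all add: expo_def t_def field_simps)
  have "complex_of_real (sin (a * x)) = 1 / (2 * \<i>) * expo t x + (- 1 / (2 * \<i>)) * expo (- t) x" for x
    unfolding e sin_of_real[symmetric] sin_exp_eq by (simp add: field_simps)
  then show ?thesis
    using expo_span_add[OF expo_span_cmult[OF expo_in_expo_span[OF UNIV_I[of t]], of "1 / (2 * \<i>)"]
        expo_span_cmult[OF expo_in_expo_span[OF UNIV_I[of "- t"]], of "- 1 / (2 * \<i>)"]]
    by simp
qed

text \<open>The real Stone-Weierstrass theorem applies to the algebra of real functions whose
  complexifications lie in the span.\<close>

lemma expo_span_approximates_continuous: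
  fixes f :: "real \<Rightarrow> real"
  assumes "continuous_on {- r..r} f" "e > 0"
  shows "\<exists>g\<in>expo_span UNIV. \<forall>x\<in>{- r..r}. cmod (complex_of_real (f x) - g x) < e"
proof -
  define R where "R = {g. continuous_on {- r..r} g \<and> (\<lambda>x. complex_of_real (g x)) \<in> expo_span UNIV}"
  interpret function_ring_on R "{- r..r}"
  proof
    fix x y :: real assume xy: "x \<in> {- r..r}" "y \<in> {- r..r}" "x \<noteq> y"
    then have r: "r > 0" by auto
    \<comment> \<open>The factor \<open>1 / r\<close> keeps the argument within [-1, 1], hence
      within [-pi/2, pi/2], where the sine is injective.\<close>
    define g where "g z = sin (1 / r * z)" for z
    have "g \<in> R"
      unfolding R_def g_def using r sin_in_expo_span[of "1 / r"] by (auto intro!: continuous_intros)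
    moreover have "\<bar>1 / r * z\<bar> \<le> pi / 2" if "z \<in> {- r..r}" for z
    proof -
      have "\<bar>1 / r * z\<bar> \<le> 1" using that r by (auto simp: abs_le_iff field_simps)
      also have "1 \<le> pi / 2" using pi_gt3 by simp
      finally show ?thesis .
    qed
    then have "g x \<noteq> g y"
      unfolding g_def using xy r sin_inj_pi[of "1 / r * x" "1 / r * y"] by (fastforce simp: abs_le_iff)
    ultimately show "\<exists>f\<in>R. f x \<noteq> f y" by blast
  next
    fix c :: real
    show "(\<lambda>_. c) \<in> R"
      unfolding R_def using expo_span_cmult[OF expo_in_expo_span[OF UNIV_I[of 0]], of "complex_of_real c"] by simp
  qed (auto simp: R_def expo_span_add expo_span_mult intro!: continuous_intros)
  obtain g where "g \<in> R" "\<forall>x\<in>{- r..r}. \<bar>f x - g x\<bar> < e"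
    using Stone_Weierstrass_basic[OF assms] by blast
  then show ?thesis
    by (intro bexI[of _ "\<lambda>x. complex_of_real (g x)"]) (auto simp: R_def simp flip: of_real_diff)
qed

text \<open>The L2 closure of the span, expressed by squared distances between representatives
  instead of in a quotient space.\<close>

definition expo_closure :: "real measure \<Rightarrow> real set \<Rightarrow> (real \<Rightarrow> complex) set" where
  "expo_closure M L = {f. square_integrable M f \<and>
     (\<forall>\<epsilon>>0. \<exists>g\<in>expo_span L. (LINT x|M. (cmod (f x - g x))\<^sup>2) < \<epsilon>)}"

section \<open>Closure properties in L2\<close>

context real_distribution
begin

lemma square_integrable_bounded:
  assumes "f \<in> borel_measurable M" "\<And>x. cmod (f x) \<le> B"
  shows "square_integrable M f"
  unfolding square_integrable_def
proof
  show "integrable M (\<lambda>x. (cmod (f x))\<^sup>2)"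
    using assms by (intro integrable_const_bound[where B="B\<^sup>2"]) (auto intro!: power_mono)
qed fact

lemma square_integrable_expo: "square_integrable M (expo l)"
  by (rule square_integrable_bounded[where B=1]) auto

lemma square_integrable_expo_span:
  assumes "g \<in> expo_span L"
  shows "square_integrable M g"
  using assms
proof induction
  case zero
  show ?case by (rule square_integrable_bounded[where B=0]) auto
qed (intro square_integrable_add square_integrable_cmult square_integrable_expo)

lemma expo_closureD:
  assumes "f \<in> expo_closure M L"
  shows "square_integrable M f"
  using assms by (simp add: expo_closure_def)

text \<open>Two approximations are chained; the factor 2 in \<open>integral_sq_add_le\<close> is the
  reason for taking each within \<open>\<epsilon> / 4\<close>.\<close>

lemma expo_closure_limit:
  assumes f: "square_integrable M f"
    and lim: "\<And>\<epsilon>. \<epsilon> > 0 \<Longrightarrow> \<exists>g\<in>expo_closure M L. (LINT x|M. (cmod (f x - g x))\<^sup>2) < \<epsilon>"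
  shows "f \<in> expo_closure M L"
  unfolding expo_closure_def
proof (intro CollectI conjI f allI impI)
  fix \<epsilon> :: real assume e: "\<epsilon> > 0"
  from lim[of "\<epsilon> / 4"] e obtain g where g: "g \<in> expo_closure M L"
    "(LINT x|M. (cmod (f x - g x))\<^sup>2) < \<epsilon> / 4" by auto
  from e have "\<epsilon> / 4 > 0" by simp
  with g(1) obtain h where h: "h \<in> expo_span L" "(LINT x|M. (cmod (g x - h x))\<^sup>2) < \<epsilon> / 4"
    unfolding expo_closure_def by blast
  have "(LINT x|M. (cmod (f x - h x))\<^sup>2) = (LINT x|M. (cmod ((f x - g x) + (g x - h x)))\<^sup>2)"
    by simp
  also have "\<dots> \<le> 2 * (LINT x|M. (cmod (f x - g x))\<^sup>2) + 2 * (LINT x|M. (cmod (g x - h x))\<^sup>2)"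
    by (intro integral_sq_add_le square_integrable_diff f expo_closureD[OF g(1)] square_integrable_expo_span[OF h(1)])
  also have "\<dots> < \<epsilon>" using g(2) h(2) by simp
  finally show "\<exists>h\<in>expo_span L. (LINT x|M. (cmod (f x - h x))\<^sup>2) < \<epsilon>" using h(1) by blast
qed

lemma expo_span_subset_closure: "expo_span L \<subseteq> expo_closure M L"
proof
  fix g assume g: "g \<in> expo_span L"
  then show "g \<in> expo_closure M L"
    unfolding expo_closure_def
    by (intro CollectI conjI square_integrable_expo_span[OF g] allI impI bexI[OF _ g]) simp
qed

lemma expo_closure_add:
  assumes f: "f \<in> expo_closure M L" and g: "g \<in> expo_closure M L"
  shows "(\<lambda>x. f x + g x) \<in> expo_closure M L"
  unfolding expo_closure_def
proof (intro CollectI conjI allI impI)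
  fix \<epsilon> :: real assume e: "\<epsilon> > 0"
  then have e4: "\<epsilon> / 4 > 0" by simp
  from f e4 obtain f' where f': "f' \<in> expo_span L" "(LINT x|M. (cmod (f x - f' x))\<^sup>2) < \<epsilon> / 4"
    unfolding expo_closure_def by blast
  from g e4 obtain g' where g': "g' \<in> expo_span L" "(LINT x|M. (cmod (g x - g' x))\<^sup>2) < \<epsilon> / 4"
    unfolding expo_closure_def by blast
  have "(LINT x|M. (cmod (f x + g x - (f' x + g' x)))\<^sup>2) = (LINT x|M. (cmod ((f x - f' x) + (g x - g' x)))\<^sup>2)"
    by (simp add: algebra_simps)
  also have "\<dots> \<le> 2 * (LINT x|M. (cmod (f x - f' x))\<^sup>2) + 2 * (LINT x|M. (cmod (g x - g' x))\<^sup>2)"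
    by (intro integral_sq_add_le square_integrable_diff expo_closureD[OF f] expo_closureD[OF g]
        square_integrable_expo_span[OF f'(1)] square_integrable_expo_span[OF g'(1)])
  also have "\<dots> < \<epsilon>" using f'(2) g'(2) by simp
  finally show "\<exists>h\<in>expo_span L. (LINT x|M. (cmod (f x + g x - h x))\<^sup>2) < \<epsilon>"
    using expo_span_add[OF f'(1) g'(1)] by (intro bexI[of _ "\<lambda>x. f' x + g' x"])
qed (intro square_integrable_add expo_closureD[OF f] expo_closureD[OF g])

lemma expo_closure_cmult:
  assumes f: "f \<in> expo_closure M L"
  shows "(\<lambda>x. c * f x) \<in> expo_closure M L"
  unfolding expo_closure_def
proof (intro CollectI conjI allI impI)
  fix \<epsilon> :: real assume e: "\<epsilon> > 0"
  \<comment> \<open>The summand 1 keeps the denominator positive when \<open>c = 0\<close>.\<close>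
  define \<delta> where "\<delta> = \<epsilon> / ((cmod c)\<^sup>2 + 1)"
  have pos: "(cmod c)\<^sup>2 + 1 > 0" by (simp add: add_nonneg_pos)
  then have "\<delta> > 0" using e by (simp add: \<delta>_def)
  with f obtain g where g: "g \<in> expo_span L" "(LINT x|M. (cmod (f x - g x))\<^sup>2) < \<delta>"
    unfolding expo_closure_def by blast
  have "(LINT x|M. (cmod (c * f x - c * g x))\<^sup>2) = (cmod c)\<^sup>2 * (LINT x|M. (cmod (f x - g x))\<^sup>2)"
    by (simp add: right_diff_distrib[symmetric] norm_mult power_mult_distrib)
  also have "\<dots> \<le> (cmod c)\<^sup>2 * \<delta>" using g(2) by (intro mult_left_mono) auto
  also have "\<dots> < ((cmod c)\<^sup>2 + 1) * \<delta>" using \<open>\<delta> > 0\<close> by (simp add: distrib_right)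
  also have "\<dots> = \<epsilon>" using pos by (simp add: \<delta>_def)
  finally show "\<exists>h\<in>expo_span L. (LINT x|M. (cmod (c * f x - h x))\<^sup>2) < \<epsilon>"
    using expo_span_cmult[OF g(1)] by (intro bexI[of _ "\<lambda>x. c * g x"])
qed (intro square_integrable_cmult expo_closureD[OF f])

lemma expo_closure_zero: "(\<lambda>_. 0) \<in> expo_closure M L"
  using expo_span_subset_closure expo_span.zero by blast

lemma expo_closure_sum:
  assumes "\<And>i. i \<in> I \<Longrightarrow> f i \<in> expo_closure M L"
  shows "(\<lambda>x. \<Sum>i\<in>I. f i x) \<in> expo_closure M L"
  using assms
  by (induction I rule: infinite_finite_induct) (auto intro: expo_closure_zero expo_closure_add)

text \<open>Dominated convergence turns a pointwise limit into an L2 limit: limit and approximants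
  are both bounded by \<open>w\<close>, so 4 w^2 dominates the squared differences.\<close>

lemma expo_closure_dominated:
  assumes s: "\<And>i. s i \<in> expo_closure M L" and f [measurable]: "f \<in> borel_measurable M"
    and w: "integrable M (\<lambda>x. (w x)\<^sup>2)" and bound: "\<And>i x. cmod (s i x) \<le> w x"
    and lim: "\<And>x. (\<lambda>i. s i x) \<longlonglongrightarrow> f x"
  shows "f \<in> expo_closure M L"
proof (rule expo_closure_limit)
  note [measurable] = square_integrableD(1)[OF expo_closureD[OF s]]
  have fw: "cmod (f x) \<le> w x" for x
    by (rule LIMSEQ_le_const2[OF tendsto_norm[OF lim]]) (use bound in auto)
  have w0: "0 \<le> w x" for x using bound[of 0 x] norm_ge_zero order_trans by blast
  show f2: "square_integrable M f"
    unfolding square_integrable_def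
  proof
    show "integrable M (\<lambda>x. (cmod (f x))\<^sup>2)"
      by (rule Bochner_Integration.integrable_bound[OF w]) (use fw w0 in \<open>auto intro!: power_mono\<close>)
  qed fact
  have "(\<lambda>i. LINT x|M. (cmod (f x - s i x))\<^sup>2) \<longlonglongrightarrow> (LINT x|M. 0)"
  proof (rule integral_dominated_convergence)
    show "integrable M (\<lambda>x. 4 * (w x)\<^sup>2)" using w by simp
    show "AE x in M. (\<lambda>i. (cmod (f x - s i x))\<^sup>2) \<longlonglongrightarrow> 0"
    proof (rule AE_I2)
      fix x
      have "(\<lambda>i. (cmod (f x - s i x))\<^sup>2) \<longlonglongrightarrow> (cmod (f x - f x))\<^sup>2"
        by (intro tendsto_intros lim)
      then show "(\<lambda>i. (cmod (f x - s i x))\<^sup>2) \<longlonglongrightarrow> 0" by simp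
    qed
    show "AE x in M. norm ((cmod (f x - s i x))\<^sup>2) \<le> 4 * (w x)\<^sup>2" for i
    proof (rule AE_I2)
      fix x
      have "cmod (f x - s i x) \<le> 2 * w x"
        using norm_triangle_ineq4[of "f x" "s i x"] fw[of x] bound[of i x] by linarith
      then have "(cmod (f x - s i x))\<^sup>2 \<le> (2 * w x)\<^sup>2" by (intro power_mono) auto
      then show "norm ((cmod (f x - s i x))\<^sup>2) \<le> 4 * (w x)\<^sup>2" by simp
    qed
  qed simp_all
  then have L: "(\<lambda>i. LINT x|M. (cmod (f x - s i x))\<^sup>2) \<longlonglongrightarrow> 0" by simp
  fix \<epsilon> :: real assume "\<epsilon> > 0"
  with L have "\<forall>\<^sub>F i in sequentially. (LINT x|M. (cmod (f x - s i x))\<^sup>2) < \<epsilon>"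
    by (rule order_tendstoD)
  then show "\<exists>g\<in>expo_closure M L. (LINT x|M. (cmod (f x - g x))\<^sup>2) < \<epsilon>"
    using s by (auto simp: eventually_sequentially)
qed

lemma expo_closure_bounded_limit:
  assumes "\<And>i. s i \<in> expo_closure M L" "f \<in> borel_measurable M"
    and "\<And>i x. cmod (s i x) \<le> B" "\<And>x. (\<lambda>i. s i x) \<longlonglongrightarrow> f x"
  shows "f \<in> expo_closure M L"
  by (rule expo_closure_dominated[where w="\<lambda>_. B"]) (use assms in auto)

section \<open>From exponentials to all square integrable functions\<close>

context
  fixes L r
  assumes expo_in: "\<And>t. expo t \<in> expo_closure M L"
    and supp: "AE x in M. x \<in> {- r..r}"
begin

lemma expo_span_UNIV_subset_closure: "expo_span UNIV \<subseteq> expo_closure M L"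
proof
  fix g assume "g \<in> expo_span UNIV"
  then show "g \<in> expo_closure M L"
  proof induction
    case (step l g c)
    show ?case by (intro expo_closure_add expo_closure_cmult expo_in step.IH)
  qed (rule expo_closure_zero)
qed

text \<open>The uniform approximation holds on \<open>{- r..r}\<close>, which carries the measure,
  and on a probability space a uniform bound passes to the L2 distance. The bound \<open>B\<close>
  makes \<open>f\<close> square integrable.\<close>

lemma continuous_in_expo_closure:
  fixes f :: "real \<Rightarrow> real"
  assumes f: "continuous_on UNIV f" and bound: "\<And>x. \<bar>f x\<bar> \<le> B"
  shows "(\<lambda>x. complex_of_real (f x)) \<in> expo_closure M L"
proof (rule expo_closure_limit)
  have [measurable]: "f \<in> borel_measurable borel" using f by (rule borel_measurable_continuous_onI)
  show sq: "square_integrable M (\<lambda>x. complex_of_real (f x))"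
    by (rule square_integrable_bounded[where B=B]) (use bound in auto)
  fix \<epsilon> :: real assume e: "\<epsilon> > 0"
  define \<delta> where "\<delta> = sqrt (\<epsilon> / 2)"
  have d: "\<delta> > 0" "\<delta>\<^sup>2 = \<epsilon> / 2" using e by (auto simp: \<delta>_def)
  obtain g where g: "g \<in> expo_span UNIV" "\<forall>x\<in>{- r..r}. cmod (complex_of_real (f x) - g x) < \<delta>"
    using expo_span_approximates_continuous[OF continuous_on_subset[OF f] d(1)] by blast
  have "(LINT x|M. (cmod (complex_of_real (f x) - g x))\<^sup>2) \<le> (LINT x|M. \<delta>\<^sup>2)"
  proof (rule integral_mono_AE)
    show "integrable M (\<lambda>x. (cmod (complex_of_real (f x) - g x))\<^sup>2)"
      by (intro square_integrableD(2) square_integrable_diff sq square_integrable_expo_span[OF g(1)])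
    show "AE x in M. (cmod (complex_of_real (f x) - g x))\<^sup>2 \<le> \<delta>\<^sup>2"
      using supp
    proof eventually_elim
      case (elim x)
      with g(2) have "cmod (complex_of_real (f x) - g x) \<le> \<delta>" by (auto intro: less_imp_le)
      then show ?case by (intro power_mono) auto
    qed
  qed simp
  also have "\<dots> < \<epsilon>" using d e prob_space by simp
  finally show "\<exists>g\<in>expo_closure M L. (LINT x|M. (cmod (complex_of_real (f x) - g x))\<^sup>2) < \<epsilon>"
    using g(1) expo_span_UNIV_subset_closure by blast
qed

lemma indicator_atMost_in_expo_closure: "(indicator {..a} :: real \<Rightarrow> complex) \<in> expo_closure M L"
proof (rule expo_closure_bounded_limit[where B=1])
  \<comment> \<open>Continuous ramps: 1 up to \<open>a\<close>, then falling linearly to 0 at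
    \<open>a + 1 / i\<close> (constantly 1 for \<open>i = 0\<close>).\<close>
  let ?s = "\<lambda>(i::nat) x. max 0 (min 1 (1 - real i * (x - a)))"
  show "(\<lambda>x. complex_of_real (?s i x)) \<in> expo_closure M L" for i
    by (rule continuous_in_expo_closure[where B=1]) (auto intro!: continuous_intros)
  show "cmod (complex_of_real (?s i x)) \<le> 1" for i x
    by auto
  show "(\<lambda>i. complex_of_real (?s i x)) \<longlonglongrightarrow> indicator {..a} x" for x
  proof (cases "x \<le> a")
    case True
    then have "?s i x = 1" for i
      by (auto simp: mult_le_0_iff max_def min_def)
    then show ?thesis using True by simp
  next
    case False
    then obtain n :: nat where n: "1 < real n * (x - a)"
      using reals_Archimedean3[of "x - a"] by auto
    have "?s i x = 0" if "i \<ge> n" for i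
    proof -
      have "real n * (x - a) \<le> real i * (x - a)" using that False by (intro mult_right_mono) auto
      then show ?thesis using n by simp
    qed
    then have "\<forall>\<^sub>F i in sequentially. complex_of_real (?s i x) = 0"
      unfolding eventually_sequentially by (metis of_real_0)
    then show ?thesis using False by (simp add: tendsto_eventually)
  qed
qed simp

text \<open>A pi-lambda argument from the half-lines. Complements use that the exponential of
  frequency 0 is the constant 1, and countable disjoint unions are bounded pointwise limits of
  finite ones.\<close>

lemma indicator_in_expo_closure:
  assumes "A \<in> sets borel"
  shows "(indicator A :: real \<Rightarrow> complex) \<in> expo_closure M L"
proof -
  have "Int_stable (range (\<lambda>a::real. {..a}))" by (auto simp: Int_stable_def)
  moreover have "range (\<lambda>a::real. {..a}) \<subseteq> Pow UNIV" by simp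
  moreover have "A \<in> sigma_sets UNIV (range (\<lambda>a::real. {..a}))"
    using assms unfolding borel_eq_atMost by simp
  ultimately show ?thesis
  proof (induction rule: sigma_sets_induct_disjoint)
    case (basic A)
    then show ?case using indicator_atMost_in_expo_closure by auto
  next
    case empty
    show ?case using expo_closure_zero by simp
  next
    case (compl A)
    have "(indicator (UNIV - A) :: real \<Rightarrow> complex) = (\<lambda>x. expo 0 x + (- 1) * indicator A x)"
      by (auto simp: fun_eq_iff split: split_indicator)
    then show ?case by (simp only: expo_closure_add[OF expo_in expo_closure_cmult[OF compl(2)]])
  next
    case (union A)
    have [measurable]: "A i \<in> sets borel" for i
      using union(2) unfolding borel_eq_atMost by auto
    have "(indicator (\<Union>i<n. A i) :: real \<Rightarrow> complex) = (\<lambda>x. \<Sum>i<n. indicator (A i) x)" for n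
      by (intro ext indicator_UN_disjoint) (use union(1) in \<open>auto simp: disjoint_family_on_def\<close>)
    then have *: "(indicator (\<Union>i<n. A i) :: real \<Rightarrow> complex) \<in> expo_closure M L" for n
      using expo_closure_sum[of "{..<n}" "\<lambda>i. indicator (A i)"] union(3) by simp
    show ?case
    proof (rule expo_closure_bounded_limit[OF *, where B=1])
      show "(\<lambda>n. indicator (\<Union>i<n. A i) x :: complex) \<longlonglongrightarrow> indicator (\<Union>i. A i) x" for x
        by (rule LIMSEQ_indicator_UN)
      show "cmod (indicator (\<Union>i<n. A i) x) \<le> 1" for n x
        by (simp add: indicator_def)
    qed measurable
  qed
qed

text \<open>Simple functions are finite combinations of indicators, and the approximating ones can
  be chosen bounded by \<open>2 * cmod (f x)\<close>, which provides the dominating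
  function.\<close>

lemma square_integrable_in_expo_closure:
  assumes "square_integrable M f"
  shows "f \<in> expo_closure M L"
proof -
  note f = square_integrableD[OF assms]
  obtain s where s: "\<And>i. simple_function M (s i)" "\<And>x. (\<lambda>i. s i x) \<longlonglongrightarrow> f x"
    "\<And>i x. cmod (s i x) \<le> 2 * cmod (f x)"
    using borel_measurable_implies_sequence_metric[OF f(1), of 0] by auto
  have "s i \<in> expo_closure M L" for i
  proof -
    have fin: "finite (range (s i))" using simple_functionD(1)[OF s(1)] by simp
    have "s i = (\<lambda>x. \<Sum>y\<in>range (s i). y * indicator (s i -` {y}) x)"
    proof
      fix x
      have "(\<Sum>y\<in>range (s i). y * indicator (s i -` {y}) x) = (\<Sum>y\<in>range (s i). if y = s i x then y else 0)"
        by (intro sum.cong) (auto split: split_indicator)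
      then show "s i x = (\<Sum>y\<in>range (s i). y * indicator (s i -` {y}) x)"
        using fin by simp
    qed
    moreover have "s i -` {y} \<in> sets borel" for y
      using simple_functionD(2)[OF s(1), of i "{y}"] by simp
    then have "(\<lambda>x. \<Sum>y\<in>range (s i). y * indicator (s i -` {y}) x) \<in> expo_closure M L"
      by (intro expo_closure_sum expo_closure_cmult indicator_in_expo_closure)
    ultimately show ?thesis by simp
  qed
  then show ?thesis
    by (rule expo_closure_dominated[where w="\<lambda>x. 2 * cmod (f x)"])
      (use f s in \<open>auto simp: power_mult_distrib\<close>)
qed

end

end

subsection \<open>Spectrality\<close>

text \<open>Both maps send \<open>{- (4 * s)..1 + 4 * s}\<close> into \<open>{- s..1 + s}\<close>,
  so by invariance the smaller interval has at least the measure of the larger one. Iteration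
  compares it with intervals exhausting the line.\<close>

lemma measure_mu4_interval:
  assumes "r > 0"
  shows "measure \<mu>4 {- r..1 + r} = 1"
proof -
  have step: "measure \<mu>4 {- (4 * s)..1 + 4 * s} \<le> measure \<mu>4 {- s..1 + s}" if "s > 0" for s :: real
  proof -
    have "measure \<mu>4 {- (4 * s)..1 + 4 * s} \<le> measure \<mu>4 (bc_map i -` {- s..1 + s})" if i: "i \<le> 1" for i
    proof (rule mu4.finite_measure_mono)
      show "{- (4 * s)..1 + 4 * s} \<subseteq> bc_map i -` {- s..1 + s}"
        using i \<open>s > 0\<close> by (cases "i = 0") (auto simp: bc_map_def field_simps)
      show "bc_map i -` {- s..1 + s} \<in> sets \<mu>4"
        using measurable_sets[OF bc_map_measurable, of "{- s..1 + s}" i] by simp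
    qed
    from this[of 0] this[of 1] show ?thesis
      using bc_invariant_bernoulli_convolution4[unfolded bc_invariant_def, rule_format, of "{- s..1 + s}"]
      by simp
  qed
  have "measure \<mu>4 {- (4 ^ n * r)..1 + 4 ^ n * r} \<le> measure \<mu>4 {- r..1 + r}" for n
  proof (induction n)
    case (Suc n)
    then show ?case using step[of "4 ^ n * r"] assms by (simp add: mult.assoc)
  qed simp
  moreover have "(\<lambda>n. measure \<mu>4 {- (4 ^ n * r)..1 + 4 ^ n * r}) \<longlonglongrightarrow> measure \<mu>4 (\<Union>n. {- (4 ^ n * r)..1 + 4 ^ n * r})"
  proof (rule mu4.finite_Lim_measure_incseq)
    show "incseq (\<lambda>n. {- (4 ^ n * r)..1 + 4 ^ n * r})"
    proof (rule incseq_SucI)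
      fix n
      have "4 ^ n * r \<le> 4 ^ Suc n * r" using assms by simp
      then show "{- (4 ^ n * r)..1 + 4 ^ n * r} \<le> {- (4 ^ Suc n * r)..1 + 4 ^ Suc n * r}"
        by (simp only: atLeastatMost_subset_iff neg_le_iff_le add_left_mono simp_thms)
    qed
  qed auto
  moreover have "(\<Union>n. {- (4 ^ n * r)..1 + 4 ^ n * r}) = (UNIV :: real set)"
  proof -
    have "\<exists>n. x \<in> {- (4 ^ n * r)..1 + 4 ^ n * r}" for x
    proof -
      obtain n where "\<bar>x\<bar> / r < 4 ^ n" using real_arch_pow[of 4 "\<bar>x\<bar> / r"] by auto
      then have "\<bar>x\<bar> < 4 ^ n * r" using assms by (simp add: field_simps)
      then show ?thesis by (intro exI[of _ n]) auto
    qed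
    then show ?thesis by auto
  qed
  ultimately have "1 \<le> measure \<mu>4 {- r..1 + r}"
    using mu4.prob_space by (intro LIMSEQ_le_const2) auto
  then show ?thesis using mu4.prob_le_1 by (intro antisym)
qed

lemma AE_mu4_interval: "AE x in \<mu>4. x \<in> {- 2..2}"
proof -
  have "AE x in \<mu>4. x \<in> {- 1..1 + 1}"
    by (rule mu4.AE_prob_1) (use measure_mu4_interval[of 1] in simp)
  then show ?thesis by eventually_elim auto
qed

text \<open>The squared distance from \<open>expo t\<close> to its projection onto the first
  \<open>n\<close> frequencies is 1 minus a partial sum of the series at \<open>- t\<close>, and so
  tends to 0.\<close>

lemma expo_in_closure_if_spectral_sum_1:
  assumes "odd K" and one: "spectral_sum K (- t) = 1"
  shows "expo t \<in> expo_closure \<mu>4 (range (freq K))"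
  unfolding expo_closure_def
proof (intro CollectI conjI mu4.square_integrable_expo allI impI)
  fix \<epsilon> :: real assume "\<epsilon> > 0"
  have "(\<lambda>n. \<Sum>k<n. energy4 (- t + freq K k)) \<longlonglongrightarrow> 1"
    using summable_LIMSEQ[OF summable_spectral_sum[OF assms(1)]] one unfolding spectral_sum_def by metis
  then have "\<forall>\<^sub>F n in sequentially. 1 - \<epsilon> < (\<Sum>k<n. energy4 (- t + freq K k))"
    by (rule order_tendstoD) (use \<open>\<epsilon> > 0\<close> in simp)
  then obtain n where n: "1 - \<epsilon> < (\<Sum>k<n. energy4 (- t + freq K k))"
    by (auto simp: eventually_sequentially)
  let ?F = "freq K ` {..<n}"
  let ?g = "\<lambda>x. \<Sum>l\<in>?F. fourier4 (t - l) * expo l x"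
  have "(\<Sum>l\<in>?F. energy4 (t - l)) = (\<Sum>k<n. energy4 (t - freq K k))"
    using inj_on_subset[OF inj_freq[OF assms(1)]] by (subst sum.reindex) auto
  also have "\<dots> = (\<Sum>k<n. energy4 (- t + freq K k))"
    using energy4_uminus[of "t - freq K k" for k] by simp
  finally have "(LINT x|\<mu>4. (cmod (expo t x - ?g x))\<^sup>2) = 1 - (\<Sum>k<n. energy4 (- t + freq K k))"
    using fourier4_range_freq_diff[OF assms(1)] by (subst expo_dist_sq_projection) auto
  then have "(LINT x|\<mu>4. (cmod (expo t x - ?g x))\<^sup>2) < \<epsilon>" using n by simp
  moreover have "?g \<in> expo_span (range (freq K))" by (rule expo_span_sum) auto
  ultimately show "\<exists>g\<in>expo_span (range (freq K)). (LINT x|\<mu>4. (cmod (expo t x - g x))\<^sup>2) < \<epsilon>"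
    by (rule bexI[of _ ?g])
qed

lemma is_spectrum_if_spectral_sum_1:
  assumes "odd K" and one: "\<And>t. spectral_sum K t = 1"
  shows "is_spectrum \<mu>4 (range (freq K))"
  unfolding is_spectrum_def
proof (intro conjI ballI impI allI)
  fix k l assume "k \<in> range (freq K)" "l \<in> range (freq K)" "k \<noteq> l"
  then have "fourier4 (k - l) = 0" by (rule fourier4_range_freq_diff[OF assms(1)])
  then show "(LINT x|\<mu>4. expo k x * cnj (expo l x)) = 0"
    by (simp add: cnj_expo expo_mult fourier4_def)
next
  fix f :: "real \<Rightarrow> complex" and \<epsilon> :: real
  assume f: "square_integrable \<mu>4 f" and e: "\<epsilon> > 0"
  have "f \<in> expo_closure \<mu>4 (range (freq K))"
    using expo_in_closure_if_spectral_sum_1[OF assms(1) one] AE_mu4_interval f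
    by (rule mu4.square_integrable_in_expo_closure)
  with e obtain g where g: "g \<in> expo_span (range (freq K))" "(LINT x|\<mu>4. (cmod (f x - g x))\<^sup>2) < \<epsilon>"
    unfolding expo_closure_def by blast
  from expo_span_explicit[OF g(1)] obtain F c
    where "finite F" "F \<subseteq> range (freq K)" "g = (\<lambda>x. \<Sum>l\<in>F. c l * expo l x)" by blast
  with g(2) show "\<exists>F c. finite F \<and> F \<subseteq> range (freq K) \<and>
      (LINT x|\<mu>4. (cmod (f x - (\<Sum>l\<in>F. c l * expo l x)))\<^sup>2) < \<epsilon>"
    by (intro exI[of _ F] exI[of _ c]) simp
qed simp

lemma not_is_spectrum_if_cycle_point:
  assumes "odd K" "cycle_point K x"
  shows "\<not> is_spectrum \<mu>4 (range (freq K))"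
proof
  assume spec: "is_spectrum \<mu>4 (range (freq K))"
  let ?t = "- real_of_int x"
  \<comment> \<open>Tolerance 1 is the squared norm of the exponential. Since it is orthogonal to
    all of \<open>F\<close>, no combination can come closer than that.\<close>
  obtain F c where Fc: "finite F" "F \<subseteq> range (freq K)"
    and less: "(LINT y|\<mu>4. (cmod (expo ?t y - (\<Sum>l\<in>F. c l * expo l y)))\<^sup>2) < 1"
    using spec mu4.square_integrable_expo[of ?t] zero_less_one unfolding is_spectrum_def by blast
  have zero: "fourier4 (?t - l) = 0" if l: "l \<in> F" for l
  proof -
    obtain k where k: "l = freq K k" using l Fc(2) by blast
    obtain n c where nc: "odd c" "x + K * int (base4 k) = 4 ^ n * c"
      using cycle_point_add_base4[OF assms(2,1)] by blast
    have "?t - l = - real_of_int (x + K * int (base4 k))"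
      by (simp add: k freq_def)
    also have "\<dots> = - (4 ^ n * real_of_int c)"
      unfolding nc(2) by simp
    finally show ?thesis
      using energy4_eq_0[OF nc(1), of n] by (simp only: fourier4_eq_0_iff energy4_uminus)
  qed
  have "fourier4 (k - l) = 0" if "k \<in> F" "l \<in> F" "k \<noteq> l" for k l
    using that Fc(2) by (intro fourier4_range_freq_diff[OF assms(1)]) auto
  then have "(LINT y|\<mu>4. (cmod (expo ?t y - (\<Sum>l\<in>F. c l * expo l y)))\<^sup>2) = 1 + (\<Sum>l\<in>F. (cmod (c l))\<^sup>2)"
    using Fc(1) zero by (subst expo_dist_sq) auto
  moreover have "0 \<le> (\<Sum>l\<in>F. (cmod (c l))\<^sup>2)" by (intro sum_nonneg) simp
  ultimately show False using less by linarith
qed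

section \<open>The cycle criterion\<close>

lemma is_spectrum_iff_no_cycle_point:
  assumes "odd K"
  shows "is_spectrum \<mu>4 (range (freq K)) \<longleftrightarrow> (\<nexists>x. cycle_point K x)"
proof
  assume "\<nexists>x. cycle_point K x"
  then have "spectral_sum K t = 1" for t
    using ex_cycle_point_if_spectral_sum_less_1[OF assms] spectral_sum_le_1[OF assms, of t]
    by (metis order_le_less)
  then show "is_spectrum \<mu>4 (range (freq K))"
    by (rule is_spectrum_if_spectral_sum_1[OF assms])
qed (use not_is_spectrum_if_cycle_point[OF assms] in blast)

text \<open>Digit indices are shifted between 0, ..., N - 1 and 1, ..., N. As
  \<open>4 ^ N - 1\<close> is nonzero for positive \<open>N\<close>, a nonzero multiple of it
  corresponds to a nonzero \<open>x\<close>.\<close>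

lemma ex_cycle_point_iff:
  "(\<exists>x. cycle_point K x) \<longleftrightarrow> (\<exists>N::nat. N > 0 \<and>
         (\<exists>d :: nat \<Rightarrow> int. (\<forall>j\<in>{1..N}. d j \<in> {0, 1}) \<and>
            K * (\<Sum>j=1..N. d j * 4 ^ (j - 1)) \<in> range (\<lambda>m::int. (4 ^ N - 1) * m) - {0}))"
    (is "?L \<longleftrightarrow> ?R")
proof
  assume ?L
  then obtain x N and d :: "nat \<Rightarrow> int" where x: "x \<noteq> 0" "N > 0" "\<And>j. j < N \<Longrightarrow> d j \<in> {0, 1}"
    "K * (\<Sum>j<N. d j * 4 ^ j) = (4 ^ N - 1) * x"
    unfolding cycle_point_def by blast
  have "(1 :: int) < 4 ^ N" using x(2) by (intro one_less_power) auto
  then have "(4 ^ N - 1 :: int) \<noteq> 0" by linarith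
  then have "(4 ^ N - 1) * x \<noteq> 0" using x(1) by simp
  moreover have "(\<Sum>j=1..N. d (j - 1) * 4 ^ (j - 1)) = (\<Sum>j<N. d j * 4 ^ j)"
    by (simp add: sum.atLeast1_atMost_eq)
  ultimately have "K * (\<Sum>j=1..N. d (j - 1) * 4 ^ (j - 1)) \<in> range (\<lambda>m::int. (4 ^ N - 1) * m) - {0}"
    using x(4) by auto
  moreover have "\<forall>j\<in>{1..N}. d (j - 1) \<in> {0, 1}"
  proof
    fix j assume "j \<in> {1..N}"
    then show "d (j - 1) \<in> {0, 1}" by (intro x(3)) auto
  qed
  ultimately show ?R
    using x(2) by (intro exI[of _ N] exI[of _ "\<lambda>j. d (j - 1)"] conjI)
next
  assume ?R
  then obtain N and d :: "nat \<Rightarrow> int" where N: "N > 0" and d: "\<forall>j\<in>{1..N}. d j \<in> {0, 1}"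
    and m: "K * (\<Sum>j=1..N. d j * 4 ^ (j - 1)) \<in> range (\<lambda>m::int. (4 ^ N - 1) * m) - {0}" by blast
  have sum: "(\<Sum>j=1..N. d j * 4 ^ (j - 1)) = (\<Sum>j<N. d (Suc j) * 4 ^ j)"
    by (simp add: sum.atLeast1_atMost_eq)
  obtain x where x: "K * (\<Sum>j<N. d (Suc j) * 4 ^ j) = (4 ^ N - 1) * x"
    "K * (\<Sum>j<N. d (Suc j) * 4 ^ j) \<noteq> 0"
    using m unfolding sum by blast
  then have "x \<noteq> 0" by (metis mult_zero_right)
  have "cycle_point K x"
    unfolding cycle_point_def
    by (intro conjI exI[of _ N] exI[of _ "\<lambda>j. d (Suc j)"] N x(1) \<open>x \<noteq> 0\<close> allI impI) (use d in auto)
  then show ?L by blast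
qed

theorem corollary2p7:
  fixes K :: int
  assumes "K \<ge> 3" and "odd K"
  shows "is_spectrum bernoulli_convolution4 ((\<lambda>l. real_of_int K * l) ` Lambda4) \<longleftrightarrow>
    \<not> (\<exists>N::nat. N > 0 \<and>
         (\<exists>d :: nat \<Rightarrow> int. (\<forall>j\<in>{1..N}. d j \<in> {0, 1}) \<and>
            K * (\<Sum>j=1..N. d j * 4 ^ (j - 1)) \<in> range (\<lambda>m::int. (4 ^ N - 1) * m) - {0}))"
proof -
  have "(\<lambda>l. real_of_int K * l) ` Lambda4 = range (freq K)"
    by (simp add: Lambda4_eq_range image_image freq_def[abs_def])
  then show ?thesis
    by (simp only: is_spectrum_iff_no_cycle_point[OF assms(2)] ex_cycle_point_iff)
qed

end
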